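(* Let $\mathscr{W}:\{w^{(j)}_\alpha\}$ be a toral $3$-isometric weighted $2$-shift. If $\mathscr{W}$ is a separate $2$-isometry, then the operator tuple $\mathscr{W}^{\mathfrak t}$ torally Cauchy dual to $\mathscr{W}$ exists, and the following statements are equivalent: (i) the operator tuple $\mathscr{W}^{\mathfrak t}$ is jointly subnormal; (ii) either $1-(w^{(1)}_0)^2-(w^{(2)}_0)^2+(w^{(1)}_0)^2(w^{(2)}_{\varepsilon_1})^2=0$ or $w^{(2)}_{\varepsilon_1}\le w^{(2)}_0$; (iii) either $\mathscr{W}$ is a toral $2$-isometry or $w^{(2)}_{\varepsilon_1}\le w^{(2)}_0$.
   Context: $\mathbb{Z}_+$ is the set of nonnegative integers; $\varepsilon_1=(1,0)$, $\varepsilon_2=(0,1)$, and the index $0$ means $(0,0)$. Let $\mathscr{H}$ be a complex separable Hilbert space with orthonormal basis $\{e_\alpha\}_{\alpha\in\mathbb{Z}_+^2}$. A weighted $2$-shift $\mathscr{W}=(\mathscr{W}_1,\mathscr{W}_2):\{w_\alpha^{(j)}\}$ is given by $\mathscr{W}_je_\alpha=w^{(j)}_\alpha e_{\alpha+\varepsilon_j}$, $j=1,2$; it is always assumed that all weights $w^{(j)}_\alpha$ are positive, that $\mathscr{W}_1,\mathscr{W}_2$ extend to bounded operators on $\mathscr{H}$, and that they commute. A commuting pair $T=(T_1,T_2)$ of bounded operators on a complex Hilbert space $H$ is a toral $m$-isometry ($m$ a positive integer) if $\sum_{0\le\alpha\le\beta}(-1)^{|\alpha|}\binom{\beta}{\alpha}T^{*\alpha}T^\alpha=0$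 for every $\beta\in\mathbb{Z}_+^2$ with $|\beta|=m$, where $T^\alpha=T_1^{\alpha_1}T_2^{\alpha_2}$, $T^{*\alpha}=(T^\alpha)^*$, $|\alpha|=\alpha_1+\alpha_2$, $\binom\beta\alpha=\binom{\beta_1}{\alpha_1}\binom{\beta_2}{\alpha_2}$ and $\le$ is coordinatewise. $T$ is a separate $m$-isometry if each $T_j$ is an $m$-isometry, i.e. $\sum_{i=0}^m(-1)^i\binom mi T_j^{*i}T_j^i=0$. If $T_j^*T_j$ is invertible for $j=1,2$, the operator tuple torally Cauchy dual to $T$ is $T^{\mathfrak t}=(T_1(T_1^*T_1)^{-1},T_2(T_2^*T_2)^{-1})$ (it "exists" when these inverses exist as bounded operators). A commuting pair $T$ on $H$ is jointly subnormal if there are a Hilbert space $K\supseteq H$ and commuting normal operators $N_1,N_2$ on $K$ with $T_j=N_j|_H$, $j=1,2$. *)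

theory Defs
  imports "HOL-Analysis.Analysis"
begin

section \<open>Complex Hilbert spaces\<close>

class complex_vector = real_vector +
  fixes scaleC :: "complex \<Rightarrow> 'a \<Rightarrow> 'a" (infixr "*\<^sub>C" 75)
  assumes scaleC_add_right: "a *\<^sub>C (x + y) = a *\<^sub>C x + a *\<^sub>C y"
    and scaleC_add_left: "(a + b) *\<^sub>C x = a *\<^sub>C x + b *\<^sub>C x"
    and scaleC_scaleC: "a *\<^sub>C b *\<^sub>C x = (a * b) *\<^sub>C x"
    and scaleR_scaleC: "r *\<^sub>R x = complex_of_real r *\<^sub>C x"

lemma scaleC_one: "1 *\<^sub>C x = (x :: 'a::complex_vector)"
  using scaleR_scaleC[of 1 x] by simp

global_interpretation complex_vector: vector_space "scaleC :: complex \<Rightarrow> 'a \<Rightarrow> 'a::complex_vector"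
  defines cspan = complex_vector.span
  by unfold_locales (simp_all add: scaleC_add_right scaleC_add_left scaleC_scaleC scaleC_one)

text \<open>The inner product is linear in the first and conjugate-linear in the second argument.\<close>

class complex_inner = complex_vector + real_normed_vector +
  fixes cinner :: "'a \<Rightarrow> 'a \<Rightarrow> complex"
  assumes cinner_commute: "cinner x y = cnj (cinner y x)"
    and cinner_add_left: "cinner (x + y) z = cinner x z + cinner y z"
    and cinner_scaleC_left: "cinner (c *\<^sub>C x) y = c * cinner x y"
    and cinner_same: "cinner x x = complex_of_real ((norm x)\<^sup>2)"

class chilbert_space = complex_inner + complete_space

definition orthonormal_basis :: "('i \<Rightarrow> 'a::chilbert_space) \<Rightarrow> bool" where
  "orthonormal_basis e \<longleftrightarrow>
     (\<forall>i j. cinner (e i) (e j) = (if i = j then 1 else 0)) \<and> closure (cspan (range e)) = UNIV"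

section \<open>Bounded operators\<close>

definition bounded_clinear :: "('a::complex_inner \<Rightarrow> 'b::complex_inner) \<Rightarrow> bool" where
  "bounded_clinear T \<longleftrightarrow> bounded_linear T \<and> (\<forall>c x. T (c *\<^sub>C x) = c *\<^sub>C T x)"

text \<open>For a bounded operator on a Hilbert space, the function described below exists and is unique.\<close>

definition adj :: "('a::chilbert_space \<Rightarrow> 'a) \<Rightarrow> 'a \<Rightarrow> 'a" where
  "adj T = (THE S. \<forall>x y. cinner (T x) y = cinner x (S y))"

definition invertible_op :: "('a::chilbert_space \<Rightarrow> 'a) \<Rightarrow> bool" where
  "invertible_op A \<longleftrightarrow> (\<exists>B. bounded_clinear B \<and> A \<circ> B = id \<and> B \<circ> A = id)"

definition normal_op :: "('a::chilbert_space \<Rightarrow> 'a) \<Rightarrow> bool" where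
  "normal_op N \<longleftrightarrow> bounded_clinear N \<and> adj N \<circ> N = N \<circ> adj N"

definition linear_isometry :: "('a::complex_inner \<Rightarrow> 'b::complex_inner) \<Rightarrow> bool" where
  "linear_isometry V \<longleftrightarrow> bounded_clinear V \<and> (\<forall>x y. cinner (V x) (V y) = cinner x y)"

definition commuting_pair :: "('a::chilbert_space \<Rightarrow> 'a) \<Rightarrow> ('a \<Rightarrow> 'a) \<Rightarrow> bool" where
  "commuting_pair T1 T2 \<longleftrightarrow> bounded_clinear T1 \<and> bounded_clinear T2 \<and> T1 \<circ> T2 = T2 \<circ> T1"

section \<open>Classes of operator pairs\<close>

definition pair_power :: "('a \<Rightarrow> 'a) \<Rightarrow> ('a \<Rightarrow> 'a) \<Rightarrow> nat \<times> nat \<Rightarrow> 'a \<Rightarrow> 'a" where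
  "pair_power T1 T2 \<alpha> = (T1 ^^ fst \<alpha>) \<circ> (T2 ^^ snd \<alpha>)"

definition toral_isometry :: "nat \<Rightarrow> ('a::chilbert_space \<Rightarrow> 'a) \<Rightarrow> ('a \<Rightarrow> 'a) \<Rightarrow> bool" where
  "toral_isometry m T1 T2 \<longleftrightarrow> 0 < m \<and> commuting_pair T1 T2 \<and>
     (\<forall>\<beta>. fst \<beta> + snd \<beta> = m \<longrightarrow>
       (\<forall>x. (\<Sum>\<alpha>\<in>{..fst \<beta>} \<times> {..snd \<beta>}.
          ((-1) ^ (fst \<alpha> + snd \<alpha>) * real (fst \<beta> choose fst \<alpha>) * real (snd \<beta> choose snd \<alpha>))
            *\<^sub>R adj (pair_power T1 T2 \<alpha>) (pair_power T1 T2 \<alpha> x)) = 0))"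

definition m_isometry :: "nat \<Rightarrow> ('a::chilbert_space \<Rightarrow> 'a) \<Rightarrow> bool" where
  "m_isometry m T \<longleftrightarrow> 0 < m \<and> bounded_clinear T \<and>
     (\<forall>x. (\<Sum>i\<le>m. ((-1) ^ i * real (m choose i)) *\<^sub>R (adj T ^^ i) ((T ^^ i) x)) = 0)"

definition separate_isometry :: "nat \<Rightarrow> ('a::chilbert_space \<Rightarrow> 'a) \<Rightarrow> ('a \<Rightarrow> 'a) \<Rightarrow> bool" where
  "separate_isometry m T1 T2 \<longleftrightarrow> commuting_pair T1 T2 \<and> m_isometry m T1 \<and> m_isometry m T2"

text \<open>The operator tuple torally Cauchy dual to (T1, T2) is (cauchy_dual T1, cauchy_dual T2); the
  term is meaningful only under toral_cauchy_dual_exists.\<close>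

definition toral_cauchy_dual_exists :: "('a::chilbert_space \<Rightarrow> 'a) \<Rightarrow> ('a \<Rightarrow> 'a) \<Rightarrow> bool" where
  "toral_cauchy_dual_exists T1 T2 \<longleftrightarrow> invertible_op (adj T1 \<circ> T1) \<and> invertible_op (adj T2 \<circ> T2)"

definition cauchy_dual :: "('a::chilbert_space \<Rightarrow> 'a) \<Rightarrow> 'a \<Rightarrow> 'a" where
  "cauchy_dual T = T \<circ> inv (adj T \<circ> T)"

text \<open>HOL has no quantifier over types, so the type carrying the larger Hilbert space K is a
  parameter; the inclusion of H in K is a linear isometry V. If the pair has a commuting normal
  extension on any Hilbert space, it has a minimal one, whose Hilbert dimension is that of H
  (in finite dimensions because the pair is then itself normal). Hence TYPE('h) is always a
  sufficient choice of carrier, and joint subnormality itself is joint subnormality in TYPE('h).\<close>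

definition jointly_subnormal_in ::
    "'k::chilbert_space itself \<Rightarrow> ('h::chilbert_space \<Rightarrow> 'h) \<Rightarrow> ('h \<Rightarrow> 'h) \<Rightarrow> bool" where
  "jointly_subnormal_in K T1 T2 \<longleftrightarrow> commuting_pair T1 T2 \<and>
     (\<exists>(V :: 'h \<Rightarrow> 'k) N1 N2. linear_isometry V \<and>
        normal_op N1 \<and> normal_op N2 \<and> N1 \<circ> N2 = N2 \<circ> N1 \<and>
        N1 \<circ> V = V \<circ> T1 \<and> N2 \<circ> V = V \<circ> T2)"

section \<open>Weighted 2-shifts\<close>

definition weighted_2_shift ::
    "(nat \<times> nat \<Rightarrow> 'a::chilbert_space) \<Rightarrow> (nat \<times> nat \<Rightarrow> real) \<Rightarrow> (nat \<times> nat \<Rightarrow> real)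
      \<Rightarrow> ('a \<Rightarrow> 'a) \<Rightarrow> ('a \<Rightarrow> 'a) \<Rightarrow> bool" where
  "weighted_2_shift e w1 w2 W1 W2 \<longleftrightarrow>
     orthonormal_basis e \<and> (\<forall>\<alpha>. 0 < w1 \<alpha> \<and> 0 < w2 \<alpha>) \<and> commuting_pair W1 W2 \<and>
     (\<forall>\<alpha>. W1 (e \<alpha>) = w1 \<alpha> *\<^sub>R e (\<alpha> + (1, 0))) \<and>
     (\<forall>\<alpha>. W2 (e \<alpha>) = w2 \<alpha> *\<^sub>R e (\<alpha> + (0, 1)))"

end

theory Submission
  imports Defs "HOL-Complex_Analysis.Complex_Analysis"
begin

text \<open>
  Separate 2-isometricity makes \<open>\<parallel>W\<^sup>\<alpha> e\<^sub>0\<parallel>\<^sup>2 = 1 + a k + b l + c k l\<close> for \<open>\<alpha> = (k, l)\<close> with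
  \<open>a, b, c \<ge> 0\<close>, and the toral Cauchy dual has the reciprocal moments. The conditions in the theorem
  say \<open>c = 0\<close> and \<open>c \<le> a b\<close>, respectively. If \<open>c = 0\<close>, the reciprocal is a Cauchy kernel; if
  \<open>0 < c \<le> a b\<close>, it is \<open>1 / (x y - d)\<close> with \<open>d \<ge> 0\<close> and \<open>x\<close>, \<open>y\<close> affine in \<open>k\<close>, \<open>l\<close>, a power series
  with nonnegative coefficients in the product of two Cauchy kernels. In both cases it is an explicit
  Gram matrix, whose vectors span a space carrying the commuting normal extension. Conversely, a normal
  extension makes the moments against \<open>(1 - t)\<^sup>2\<^sup>m\<close> in the first variable log-convex in \<open>l\<close>; these
  decay like \<open>m\<close> to the power \<open>-(1 + b l) / (a + c l)\<close>, and the exponent is strictly convex in \<open>l\<close>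
  if \<open>c > a b\<close>. Since Fuglede's theorem is needed for this, it is proved by Rosenblum's argument with
  polynomials in place of operator exponentials.
\<close>

section \<open>Hilbert space basics\<close>

text \<open>The coefficients \<open>a\<close>, \<open>b\<close> are the increments of the squared
  norm along the axes at the origin, and \<open>c\<close> is its mixed second difference there. For
  fixed \<open>l\<close> the reciprocal moments are \<open>1 / (p + q k)\<close> with
  \<open>p = 1 + b l\<close>, \<open>q = a + c l\<close>. For \<open>q > 0\<close> these are the
  moments of a density proportional to \<open>t powr (p / q - 1)\<close> on the unit interval, so
  one variable alone never obstructs; only the coupling does. For \<open>c > 0\<close> both
  directions meet in one number: \<open>p / q = b / c + (1 - a b / c) / q\<close> is strictly convex
  in \<open>l\<close> iff \<open>a b < c\<close>, and \<open>(c k + b) (l + a / c)\<close> exceeds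
  the denominator of the moment by \<open>d = a b / c - 1\<close>. Representing measures stay in the
  background; everything is done with norms and inner products. The extension has to live in the
  type of the shift itself, so kernels are factored through square-summable sequences, which an
  orthonormal sequence turns into vectors. Boundedness of the shifts on these vectors comes for
  free: a symmetric shift of a norm-bounded family is a contraction, because the norms along its
  orbits are log-convex.\<close>

lemma scaleC_minus_one: "(-1) *\<^sub>C (x::'a::complex_vector) = - x"
  by (simp add: scaleC_one)

lemma cinner_add_right: "cinner x (y + z) = cinner x y + cinner x (z::'a::complex_inner)"
  by (metis cinner_add_left cinner_commute complex_cnj_add)

lemma cinner_scaleC_right: "cinner x (c *\<^sub>C y) = cnj c * cinner x (y::'a::complex_inner)"
  by (metis cinner_scaleC_left cinner_commute complex_cnj_mult)

lemma cinner_zero_left [simp]: "cinner 0 (x::'a::complex_inner) = 0"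
  using cinner_scaleC_left[of 0 x x] by simp

lemma cinner_zero_right [simp]: "cinner (x::'a::complex_inner) 0 = 0"
  using cinner_scaleC_right[of x 0 x] by simp

lemma cinner_minus_left: "cinner (- x) (y::'a::complex_inner) = - cinner x y"
  using cinner_scaleC_left[of "-1" x y] by (simp add: scaleC_minus_one)

lemma cinner_minus_right: "cinner x (- y) = - cinner x (y::'a::complex_inner)"
  using cinner_scaleC_right[of x "-1" y] by (simp add: scaleC_minus_one)

lemma cinner_diff_left: "cinner (x - y) z = cinner x z - cinner y (z::'a::complex_inner)"
  using cinner_add_left[of x "- y" z] by (simp add: cinner_minus_left)

lemma cinner_diff_right: "cinner x (y - z) = cinner x y - cinner x (z::'a::complex_inner)"
  using cinner_add_right[of x y "- z"] by (simp add: cinner_minus_right)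

lemma cinner_scaleR_left: "cinner (r *\<^sub>R x) y = of_real r * cinner x (y::'a::complex_inner)"
  by (simp add: scaleR_scaleC cinner_scaleC_left)

lemma cinner_scaleR_right: "cinner x (r *\<^sub>R y) = of_real r * cinner x (y::'a::complex_inner)"
  by (simp add: scaleR_scaleC cinner_scaleC_right)

lemma cinner_sum_left: "cinner (\<Sum>i\<in>A. f i) y = (\<Sum>i\<in>A. cinner (f i) (y::'a::complex_inner))"
  by (induction A rule: infinite_finite_induct) (simp_all add: cinner_add_left)

lemma cinner_sum_right: "cinner x (\<Sum>i\<in>A. f i) = (\<Sum>i\<in>A. cinner x (f i::'a::complex_inner))"
  by (induction A rule: infinite_finite_induct) (simp_all add: cinner_add_right)

lemma norm_scaleC: "norm (c *\<^sub>C x) = cmod c * norm (x::'a::complex_inner)"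
proof -
  have "complex_of_real ((norm (c *\<^sub>C x))\<^sup>2) = of_real ((cmod c * norm x)\<^sup>2)"
    unfolding cinner_same[symmetric] cinner_scaleC_left cinner_scaleC_right
    using complex_norm_square[of c] by (simp add: cinner_same power_mult_distrib)
  then have "(norm (c *\<^sub>C x))\<^sup>2 = (cmod c * norm x)\<^sup>2"
    using of_real_eq_iff by blast
  then show ?thesis by simp
qed

lemma norm_sq_eq_Re_cinner: "(norm x)\<^sup>2 = Re (cinner x (x::'a::complex_inner))"
  by (simp add: cinner_same)

lemma norm_add_sq: "(norm (x + y))\<^sup>2 = (norm x)\<^sup>2 + (norm y)\<^sup>2 + 2 * Re (cinner x (y::'a::complex_inner))"
proof -
  have "Re (cinner y x) = Re (cinner x y)"
    by (metis cinner_commute cnj.sel(1))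
  then show ?thesis
    by (simp add: norm_sq_eq_Re_cinner cinner_add_left cinner_add_right)
qed

lemma norm_diff_sq: "(norm (x - y))\<^sup>2 = (norm x)\<^sup>2 + (norm y)\<^sup>2 - 2 * Re (cinner x (y::'a::complex_inner))"
  using norm_add_sq[of x "- y"] by (simp add: cinner_minus_right)

lemma Re_cinner_le: "Re (cinner x y) \<le> norm x * norm (y::'a::complex_inner)"
proof (cases "x = 0 \<or> y = 0")
  case False
  then have pos: "norm x > 0" "norm y > 0" by auto
  have "0 \<le> (norm (norm y *\<^sub>R x - norm x *\<^sub>R y))\<^sup>2" by simp
  also have "\<dots> = 2 * (norm x * norm y) * (norm x * norm y - Re (cinner x y))"
    unfolding norm_diff_sq by (simp add: cinner_scaleR_left cinner_scaleR_right power2_eq_square algebra_simps)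
  finally have "0 \<le> norm x * norm y - Re (cinner x y)"
    using mult_pos_pos[OF pos] by (simp add: zero_le_mult_iff)
  then show ?thesis by simp
qed auto

lemma cmod_cinner_le: "cmod (cinner x y) \<le> norm x * norm (y::'a::complex_inner)"
proof (cases "cinner x y = 0")
  case False
  define c where "c = cnj (cinner x y) / cmod (cinner x y)"
  have c: "cmod c = 1" using False by (simp add: c_def norm_divide)
  have "cinner (c *\<^sub>C x) y = cmod (cinner x y)"
    using False by (simp add: cinner_scaleC_left c_def field_simps)
      (metis complex_norm_square of_real_power power2_eq_square)
  then have "cmod (cinner x y) = Re (cinner (c *\<^sub>C x) y)" by simp
  also have "\<dots> \<le> norm (c *\<^sub>C x) * norm y" by (rule Re_cinner_le)
  finally show ?thesis by (simp add: norm_scaleC c)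
qed simp

lemma cinner_ext: "(\<And>z. cinner z x = cinner z y) \<Longrightarrow> x = (y::'a::complex_inner)"
proof -
  assume "\<And>z. cinner z x = cinner z y"
  then have "cinner (x - y) (x - y) = 0" by (simp add: cinner_diff_right)
  then show ?thesis by (simp add: cinner_same)
qed

lemma bounded_linear_cinner_left: "bounded_linear (\<lambda>x. cinner x (y::'a::complex_inner))"
  by (rule bounded_linear_intro[where K = "norm y"])
    (simp_all add: cinner_add_left cinner_scaleR_left scaleR_conv_of_real cmod_cinner_le)

lemma bounded_bilinear_cinner: "bounded_bilinear (cinner :: 'a::complex_inner \<Rightarrow> 'a \<Rightarrow> complex)"
  by (rule bounded_bilinear.intro)
    (auto simp: cinner_add_left cinner_add_right cinner_scaleR_left cinner_scaleR_right
      scaleR_conv_of_real intro!: exI[of _ 1] cmod_cinner_le)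

lemmas tendsto_cinner = bounded_bilinear.tendsto[OF bounded_bilinear_cinner]

lemma bounded_linear_scaleC: "bounded_linear (\<lambda>x::'a::complex_inner. c *\<^sub>C x)"
  by (rule bounded_linear_intro[where K = "cmod c"])
    (simp_all add: scaleC_add_right norm_scaleC scaleR_scaleC scaleC_scaleC mult.commute)

section \<open>Bounded complex-linear maps\<close>

lemma bounded_clinearI:
  assumes "\<And>x y. T (x + y) = T x + T y" "\<And>c x. T (c *\<^sub>C x) = c *\<^sub>C T x"
    "\<And>x. norm (T x) \<le> C * norm x"
  shows "bounded_clinear (T::'a::complex_inner \<Rightarrow> 'b::complex_inner)"
  unfolding bounded_clinear_def using assms
  by (auto intro!: bounded_linear_intro[where K = C] simp: scaleR_scaleC mult.commute)

context
  fixes T :: "'a::complex_inner \<Rightarrow> 'b::complex_inner"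
  assumes T: "bounded_clinear T"
begin

lemma bounded_clinear_bounded_linear: "bounded_linear T"
  using T by (simp add: bounded_clinear_def)

lemma bounded_clinear_scaleC: "T (c *\<^sub>C x) = c *\<^sub>C T x"
  using T by (simp add: bounded_clinear_def)

lemma bounded_clinear_scaleR: "T (r *\<^sub>R x) = r *\<^sub>R T x"
  using bounded_clinear_scaleC by (simp add: scaleR_scaleC)

lemma bounded_clinear_add: "T (x + y) = T x + T y"
  by (rule linear_add[OF bounded_linear.linear[OF bounded_clinear_bounded_linear]])

lemma bounded_clinear_diff: "T (x - y) = T x - T y"
  by (rule linear_diff[OF bounded_linear.linear[OF bounded_clinear_bounded_linear]])

lemma bounded_clinear_minus: "T (- x) = - T x"
  by (rule linear_neg[OF bounded_linear.linear[OF bounded_clinear_bounded_linear]])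

lemma bounded_clinear_zero: "T 0 = 0"
  by (rule linear_0[OF bounded_linear.linear[OF bounded_clinear_bounded_linear]])

lemma bounded_clinear_pos_bound: obtains C where "0 < C" "\<And>x. norm (T x) \<le> C * norm x"
  using bounded_linear.pos_bounded[OF bounded_clinear_bounded_linear] by (metis mult.commute)

lemma bounded_clinear_tendsto: "(f \<longlongrightarrow> l) F \<Longrightarrow> ((\<lambda>x. T (f x)) \<longlongrightarrow> T l) F"
  by (rule bounded_linear.tendsto[OF bounded_clinear_bounded_linear])

end

lemma bounded_clinear_compose:
  "bounded_clinear S \<Longrightarrow> bounded_clinear T \<Longrightarrow> bounded_clinear (\<lambda>x. S (T x))"
  unfolding bounded_clinear_def by (auto intro: bounded_linear_compose)

lemma bounded_clinear_comp:
  "bounded_clinear S \<Longrightarrow> bounded_clinear T \<Longrightarrow> bounded_clinear (S \<circ> T)"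
  unfolding comp_def by (rule bounded_clinear_compose)

lemma bounded_clinear_ident: "bounded_clinear (\<lambda>x. x)"
  by (simp add: bounded_clinear_def bounded_linear_ident)

lemma bounded_clinear_const_zero: "bounded_clinear (\<lambda>x. 0)"
  by (simp add: bounded_clinear_def bounded_linear_zero)

lemma bounded_clinear_fun_add:
  "bounded_clinear S \<Longrightarrow> bounded_clinear T \<Longrightarrow> bounded_clinear (\<lambda>x. S x + T x)"
  unfolding bounded_clinear_def by (auto intro: bounded_linear_add simp: scaleC_add_right)

lemma bounded_clinear_fun_scaleC:
  "bounded_clinear T \<Longrightarrow> bounded_clinear (\<lambda>x. c *\<^sub>C T x)"
  unfolding bounded_clinear_def
  by (auto intro: bounded_linear_compose[OF bounded_linear_scaleC] simp: scaleC_scaleC mult.commute)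

lemma bounded_clinear_fun_scaleR:
  "bounded_clinear T \<Longrightarrow> bounded_clinear (\<lambda>x. r *\<^sub>R T x)"
  by (simp add: scaleR_scaleC bounded_clinear_fun_scaleC)

lemma bounded_clinear_fun_diff:
  "bounded_clinear S \<Longrightarrow> bounded_clinear T \<Longrightarrow> bounded_clinear (\<lambda>x. S x - T x)"
  using bounded_clinear_fun_add[of S "\<lambda>x. (-1) *\<^sub>C T x"] bounded_clinear_fun_scaleC[of T "-1"]
  by (simp only: scaleC_minus_one) simp

lemma bounded_clinear_fun_sum:
  "(\<And>i. i \<in> A \<Longrightarrow> bounded_clinear (T i)) \<Longrightarrow> bounded_clinear (\<lambda>x. \<Sum>i\<in>A. T i x)"
  by (induction A rule: infinite_finite_induct)
    (simp_all add: bounded_clinear_const_zero bounded_clinear_fun_add)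

lemma bounded_clinear_funpow: "bounded_clinear (T :: 'a::complex_inner \<Rightarrow> 'a) \<Longrightarrow> bounded_clinear (T ^^ n)"
proof (induction n)
  case 0
  then show ?case using bounded_clinear_ident by (simp add: id_def)
next
  case (Suc n)
  then show ?case using bounded_clinear_comp[of T "T ^^ n"] by (simp add: o_def)
qed

lemma clinear_eq_on_cspan:
  assumes "bounded_clinear S" "bounded_clinear T" "\<And>i. S (g i) = T (g i)" "x \<in> closure (cspan (range g))"
  shows "S x = T x"
proof -
  have span: "S x = T x" if "x \<in> cspan (range g)" for x
    using that
  proof (induction rule: complex_vector.span_induct_alt)
    case base
    then show ?case by (simp add: assms(1,2)[THEN bounded_clinear_zero])
  next
    case (step c x y)
    then show ?case
      using assms(3) by (auto simp: assms(1,2)[THEN bounded_clinear_add] assms(1,2)[THEN bounded_clinear_scaleC])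
  qed
  from assms(4) obtain X where X: "\<And>n. X n \<in> cspan (range g)" "X \<longlonglongrightarrow> x"
    unfolding closure_sequential by auto
  have "(\<lambda>n. S (X n)) \<longlonglongrightarrow> S x" "(\<lambda>n. S (X n)) \<longlonglongrightarrow> T x"
    using assms(1,2)[THEN bounded_clinear_tendsto, OF X(2)] by (simp_all add: span[OF X(1)])
  then show ?thesis by (rule LIMSEQ_unique)
qed

section \<open>Closed subspaces, Riesz representation and projections\<close>

definition closed_csubspace :: "'a::complex_inner set \<Rightarrow> bool" where
  "closed_csubspace M \<longleftrightarrow> closed M \<and> complex_vector.subspace M"

text \<open>The representing vector minimizes \<^term>\<open>(norm z)\<^sup>2 - 2 * Re (f z)\<close> over the subspace.\<close>

lemma riesz_on_subspace:
  fixes M :: "'a::chilbert_space set" and f :: "'a \<Rightarrow> complex"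
  assumes M: "closed_csubspace M"
    and add: "\<And>x y. x \<in> M \<Longrightarrow> y \<in> M \<Longrightarrow> f (x + y) = f x + f y"
    and scale: "\<And>c x. x \<in> M \<Longrightarrow> f (c *\<^sub>C x) = c * f x"
    and bound: "\<And>x. x \<in> M \<Longrightarrow> cmod (f x) \<le> C * norm x"
  obtains z where "z \<in> M" "\<And>x. x \<in> M \<Longrightarrow> f x = cinner x z"
proof -
  have sub: "complex_vector.subspace M" and cl: "closed M" using M by (auto simp: closed_csubspace_def)
  note Madd = complex_vector.subspace_add[OF sub] and Mscale = complex_vector.subspace_scale[OF sub]
  have MscaleR: "r *\<^sub>R x \<in> M" if "x \<in> M" for r x using Mscale[OF that] by (simp add: scaleR_scaleC)
  have fscaleR: "f (r *\<^sub>R x) = of_real r * f x" if "x \<in> M" for r x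
    using scale[OF that] by (simp add: scaleR_scaleC)
  define J where "J x = (norm x)\<^sup>2 - 2 * Re (f x)" for x
  have Re_le: "Re (f x) \<le> C * norm x" if "x \<in> M" for x
    using bound[OF that] complex_Re_le_cmod[of "f x"] by linarith
  have Jlb: "J x \<ge> - C\<^sup>2" if "x \<in> M" for x
  proof -
    have "0 \<le> (norm x - C)\<^sup>2" by simp
    then show ?thesis using Re_le[OF that] unfolding J_def power2_diff by (simp add: mult.commute)
  qed
  define \<mu> where "\<mu> = Inf (J ` M)"
  have M0: "0 \<in> M" by (rule complex_vector.subspace_0[OF sub])
  have bdd: "bdd_below (J ` M)" using Jlb by (auto intro!: bdd_belowI2)
  have mule: "\<mu> \<le> J x" if "x \<in> M" for x
    unfolding \<mu>_def using bdd that by (auto intro: cINF_lower)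
  have "\<exists>x\<in>M. J x < \<mu> + 1 / real (Suc n)" for n
  proof (rule ccontr)
    assume "\<not> ?thesis"
    then have "\<mu> + 1 / real (Suc n) \<le> Inf (J ` M)"
      using M0 by (intro cINF_greatest) (auto simp: not_less)
    then show False by (simp add: \<mu>_def field_simps)
  qed
  then obtain X where X: "\<And>n. X n \<in> M" "\<And>n. J (X n) < \<mu> + 1 / real (Suc n)" by metis
  \<comment> \<open>Parallelogram law: the linear part of \<open>J\<close> cancels against that of
    the midpoint, so near-minimizers are close to each other.\<close>
  have par: "(norm (x - y))\<^sup>2 \<le> 2 * (J x + J y - 2 * \<mu>)" if "x \<in> M" "y \<in> M" for x y
  proof -
    have m: "(1/2) *\<^sub>R (x + y) \<in> M" using Madd[OF that] MscaleR by blast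
    have "J ((1/2) *\<^sub>R (x + y)) = (norm (x + y))\<^sup>2 / 4 - (Re (f x) + Re (f y))"
      unfolding J_def using that by (subst fscaleR[OF Madd])
        (simp_all add: add power_divide norm_scaleR power_mult_distrib add_divide_distrib del: scaleR_add_right)
    then have "J x + J y - 2 * J ((1/2) *\<^sub>R (x + y)) = (norm (x - y))\<^sup>2 / 2"
      unfolding norm_add_sq norm_diff_sq by (simp add: J_def field_simps)
    then show ?thesis using mule[OF m] by (simp add: field_simps)
  qed
  have "Cauchy X"
  proof (rule metric_CauchyI)
    fix e :: real assume "0 < e"
    then obtain N where N: "1 / real (Suc N) < e\<^sup>2 / 4"
      using reals_Archimedean[of "e\<^sup>2 / 4"] by (auto simp: inverse_eq_divide)
    have "dist (X m) (X n) < e" if "m \<ge> N" "n \<ge> N" for m n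
    proof -
      define d where "d k = 1 / real (Suc k)" for k
      have "d m \<le> d N" "d n \<le> d N" "d N < e\<^sup>2 / 4"
        using that N by (auto simp: d_def field_simps)
      then have "(norm (X m - X n))\<^sup>2 < e\<^sup>2"
        using par[OF X(1) X(1), of m n] X(2)[of m, folded d_def] X(2)[of n, folded d_def]
        by argo
      then show ?thesis using \<open>0 < e\<close> by (simp add: dist_norm power2_less_imp_less)
    qed
    then show "\<exists>N. \<forall>m\<ge>N. \<forall>n\<ge>N. dist (X m) (X n) < e" by blast
  qed
  then obtain z where z: "X \<longlonglongrightarrow> z" using Cauchy_convergent_iff convergent_def by blast
  have zM: "z \<in> M" using cl X(1) z by (metis closed_sequentially)
  have diff: "f (x - y) = f x - f y" if "x \<in> M" "y \<in> M" for x y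
    using add[OF complex_vector.subspace_diff[OF sub that] that(2)] by simp
  have "(\<lambda>n. f (X n) - f z) \<longlonglongrightarrow> 0"
  proof (rule tendsto_0_le)
    show "(\<lambda>n. X n - z) \<longlonglongrightarrow> 0" using z by (simp add: LIM_zero)
    show "\<forall>\<^sub>F n in sequentially. norm (f (X n) - f z) \<le> norm (X n - z) * C"
      using bound[OF complex_vector.subspace_diff[OF sub X(1) zM]]
      by (simp add: diff[OF X(1) zM] mult.commute)
  qed
  then have "(\<lambda>n. J (X n)) \<longlonglongrightarrow> J z"
    unfolding J_def using z by (intro tendsto_intros) (simp_all add: LIM_zero_iff)
  moreover have "(\<lambda>n. \<mu> + 1 / real (Suc n)) \<longlonglongrightarrow> \<mu> + 0"
    by (intro tendsto_intros lim_1_over_n[THEN LIMSEQ_Suc])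
  ultimately have Jz: "J z \<le> \<mu>"
    using X(2) by (intro LIMSEQ_le[of "\<lambda>n. J (X n)" "J z" "\<lambda>n. \<mu> + 1 / real (Suc n)"]) (auto intro: less_imp_le)
  have Re_eq: "Re (f x) = Re (cinner x z)" if "x \<in> M" for x
  proof -
    define A B where "A = (norm x)\<^sup>2" and "B = Re (cinner x z) - Re (f x)"
    have quad: "t\<^sup>2 * A + 2 * t * B \<ge> 0" for t :: real
    proof -
      have "J (z + t *\<^sub>R x) = J z + (t\<^sup>2 * A + 2 * t * B)"
        unfolding J_def A_def B_def add[OF zM MscaleR[OF that]] fscaleR[OF that] norm_add_sq[of z]
        using cinner_commute[of z x]
        by (simp add: cinner_scaleR_right algebra_simps power_mult_distrib)
      then show ?thesis using Jz mule[OF Madd[OF zM MscaleR[OF that]], of t] by linarith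
    qed
    have "A \<ge> 0" by (simp add: A_def)
    \<comment> \<open>At \<open>t = - s\<close> the quadratic form equals
      \<open>- s^2 (A + 2)\<close>; the summand 1 keeps the denominator positive even if
      \<open>x = 0\<close>.\<close>
    define s where "s = B / (A + 1)"
    have B: "B = s * (A + 1)" using \<open>A \<ge> 0\<close> by (simp add: s_def)
    have "s\<^sup>2 * (A + 2) \<le> 0" using quad[of "- s"] by (simp add: B power2_eq_square algebra_simps)
    then have "B = 0" using \<open>A \<ge> 0\<close> by (simp add: mult_le_0_iff B)
    then show ?thesis by (simp add: B_def)
  qed
  have repr: "f x = cinner x z" if "x \<in> M" for x
  proof (rule complex_eqI)
    show "Re (f x) = Re (cinner x z)" by (rule Re_eq[OF that])
    show "Im (f x) = Im (cinner x z)"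
      using Re_eq[OF Mscale[OF that, of "\<i>"]] by (simp add: scale[OF that] cinner_scaleC_left)
  qed
  show thesis by (rule that[OF zM repr])
qed

lemma closed_csubspace_UNIV: "closed_csubspace UNIV"
  by (simp add: closed_csubspace_def complex_vector.subspace_UNIV)

lemma closed_csubspace_closure_cspan: "closed_csubspace (closure (cspan S))"
proof -
  have sub: "complex_vector.subspace (cspan S)" by (rule complex_vector.subspace_span)
  have "complex_vector.subspace (closure (cspan S))"
  proof (rule complex_vector.subspaceI)
    show "0 \<in> closure (cspan S)"
      using complex_vector.subspace_0[OF sub] closure_subset by blast
  next
    fix x y assume "x \<in> closure (cspan S)" "y \<in> closure (cspan S)"
    then obtain X Y where "\<And>n. X n \<in> cspan S" "X \<longlonglongrightarrow> x" "\<And>n. Y n \<in> cspan S" "Y \<longlonglongrightarrow> y"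
      unfolding closure_sequential by auto
    then show "x + y \<in> closure (cspan S)"
      unfolding closure_sequential using complex_vector.subspace_add[OF sub] tendsto_add[of X x _ Y y]
      by (intro exI[of _ "\<lambda>n. X n + Y n"]) auto
  next
    fix c x assume "x \<in> closure (cspan S)"
    then obtain X where "\<And>n. X n \<in> cspan S" "X \<longlonglongrightarrow> x"
      unfolding closure_sequential by auto
    then show "c *\<^sub>C x \<in> closure (cspan S)"
      unfolding closure_sequential using complex_vector.subspace_scale[OF sub]
        bounded_linear.tendsto[OF bounded_linear_scaleC]
      by (intro exI[of _ "\<lambda>n. c *\<^sub>C X n"]) auto
  qed
  then show ?thesis by (simp add: closed_csubspace_def)
qed

text \<open>The projection is the Riesz vector of the functional
  \<open>\<lambda>x. cinner x y\<close> restricted to the subspace.\<close>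

lemma orthogonal_projection:
  fixes M :: "'a::chilbert_space set"
  assumes M: "closed_csubspace M"
  obtains p where "p \<in> M" "\<And>x. x \<in> M \<Longrightarrow> cinner x (y - p) = 0"
proof -
  obtain p where "p \<in> M" "\<And>x. x \<in> M \<Longrightarrow> cinner x y = cinner x p"
    by (rule riesz_on_subspace[OF M, of "\<lambda>x. cinner x y" "norm y"])
      (auto simp: cinner_add_left cinner_scaleC_left mult.commute[of "norm y"] intro: cmod_cinner_le)
  with that show thesis by (simp add: cinner_diff_right)
qed

section \<open>Adjoints and normal operators\<close>

lemma adj_exists:
  fixes T :: "'a::chilbert_space \<Rightarrow> 'a"
  assumes T: "bounded_clinear T"
  shows "\<exists>!S. \<forall>x y. cinner (T x) y = cinner x (S y)"
proof -
  obtain C where C: "0 < C" "\<And>x. norm (T x) \<le> C * norm x" using bounded_clinear_pos_bound[OF T] by blast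
  have "\<exists>z. \<forall>x. cinner (T x) y = cinner x z" for y
  proof -
    have "cmod (cinner (T x) y) \<le> C * norm y * norm x" for x
      using cmod_cinner_le[of "T x" y] mult_right_mono[OF C(2)[of x] norm_ge_zero[of y]]
      by (simp add: ac_simps)
    then show ?thesis
      by (rule_tac riesz_on_subspace[OF closed_csubspace_UNIV, of "\<lambda>x. cinner (T x) y" "C * norm y"])
        (simp_all add: bounded_clinear_add[OF T] bounded_clinear_scaleC[OF T]
          cinner_add_left cinner_scaleC_left, metis)
  qed
  then obtain S where S: "\<forall>x y. cinner (T x) y = cinner x (S y)" by metis
  moreover have "S' = S"
    if S': "\<forall>x y. cinner (T x) y = cinner x (S' y)" for S'
  proof
    fix y
    show "S' y = S y" by (rule cinner_ext) (simp add: S[rule_format, symmetric] S'[rule_format, symmetric])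
  qed
  ultimately show ?thesis by (intro ex1I[of _ S]) auto
qed

lemma cinner_adj_right:
  assumes "bounded_clinear T"
  shows "cinner x (adj T y) = cinner (T x) (y::'a::chilbert_space)"
proof -
  have "\<forall>x y. cinner (T x) y = cinner x (adj T y)"
    unfolding adj_def by (rule theI'[OF adj_exists[OF assms]])
  then show ?thesis by simp
qed

lemma cinner_adj_left:
  "bounded_clinear T \<Longrightarrow> cinner (adj T x) y = cinner x (T (y::'a::chilbert_space))"
  using cinner_adj_right[of T y x] cinner_commute[of "adj T x" y] cinner_commute[of x "T y"] by simp

lemma adj_eqI:
  assumes "\<And>x y. cinner (T x) y = cinner x (S y)" "bounded_clinear T"
  shows "adj T = (S :: 'a::chilbert_space \<Rightarrow> 'a)"
  by (intro ext cinner_ext) (simp add: cinner_adj_right assms)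

lemma bounded_clinear_adj:
  fixes T :: "'a::chilbert_space \<Rightarrow> 'a"
  assumes T: "bounded_clinear T"
  shows "bounded_clinear (adj T)"
proof -
  obtain C where C: "0 < C" "\<And>x. norm (T x) \<le> C * norm x" using bounded_clinear_pos_bound[OF T] by blast
  show ?thesis
  proof (rule bounded_clinearI)
    show "adj T (x + y) = adj T x + adj T y" for x y
      by (rule cinner_ext) (simp add: cinner_adj_right[OF T] cinner_add_right)
    show "adj T (c *\<^sub>C x) = c *\<^sub>C adj T x" for c x
      by (rule cinner_ext) (simp add: cinner_adj_right[OF T] cinner_scaleC_right)
    show "norm (adj T x) \<le> C * norm x" for x
    proof -
      have "(norm (adj T x))\<^sup>2 = Re (cinner (T (adj T x)) x)"
        by (simp add: norm_sq_eq_Re_cinner cinner_adj_right[OF T])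
      also have "\<dots> \<le> norm (T (adj T x)) * norm x" by (rule Re_cinner_le)
      also have "\<dots> \<le> C * norm (adj T x) * norm x" by (intro mult_right_mono C norm_ge_zero)
      finally have "norm (adj T x) * norm (adj T x) \<le> norm (adj T x) * (C * norm x)"
        by (simp add: power2_eq_square ac_simps)
      then show ?thesis using C(1) by (cases "adj T x = 0") auto
    qed
  qed
qed

lemma adj_comp:
  assumes "bounded_clinear S" "bounded_clinear T"
  shows "adj (S \<circ> T) = adj T \<circ> (adj S :: 'a::chilbert_space \<Rightarrow> 'a)"
proof (rule adj_eqI)
  show "cinner ((S \<circ> T) x) y = cinner x ((adj T \<circ> adj S) y)" for x y
    by (simp add: cinner_adj_right[OF assms(1)] cinner_adj_right[OF assms(2)])
qed (rule bounded_clinear_comp[OF assms])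

lemma adj_funpow:
  assumes "bounded_clinear T"
  shows "adj T ^^ n = adj (T ^^ n :: 'a::chilbert_space \<Rightarrow> 'a)"
proof (induction n)
  case 0
  then show ?case by (simp add: id_def adj_eqI bounded_clinear_ident)
next
  case (Suc n)
  have "adj (T ^^ Suc n) = adj T \<circ> adj (T ^^ n)"
    using adj_comp[OF bounded_clinear_funpow[OF assms] assms, of n] by (simp only: funpow_Suc_right)
  then show ?case by (simp only: funpow.simps(2)[of n "adj T"] Suc.IH)
qed

lemma normal_op_norm_adj:
  assumes "normal_op N"
  shows "norm (adj N x) = norm (N (x::'a::chilbert_space))"
proof -
  have N: "bounded_clinear N" and c: "adj N (N y) = N (adj N y)" for y
    using assms by (auto simp: normal_op_def fun_eq_iff)
  have "cinner (adj N x) (adj N x) = cinner (N x) (N x)"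
    by (simp add: cinner_adj_right[OF N] cinner_adj_left[OF N] c[symmetric])
  then have "(norm (adj N x))\<^sup>2 = (norm (N x))\<^sup>2" by (simp add: norm_sq_eq_Re_cinner)
  then show ?thesis by simp
qed

text \<open>The closure of the graph on the span is the graph of the extension to the closed span.\<close>

lemma bounded_clinear_extension:
  fixes g :: "'i \<Rightarrow> 'a::chilbert_space" and h :: "'i \<Rightarrow> 'b::chilbert_space"
  assumes bound: "\<And>F c. finite F \<Longrightarrow> norm (\<Sum>i\<in>F. c i *\<^sub>C h i) \<le> C * norm (\<Sum>i\<in>F. c i *\<^sub>C g i)"
  obtains T where "bounded_clinear T" "\<And>i. T (g i) = h i"
    "\<And>x. (\<And>i. cinner (g i) x = 0) \<Longrightarrow> T x = 0"
proof -
  let ?M = "closure (cspan (range g))"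
  have M: "closed_csubspace ?M" by (rule closed_csubspace_closure_cspan)
  then have sub: "complex_vector.subspace ?M" by (simp add: closed_csubspace_def)
  define R where "R = {((\<Sum>i\<in>F. c i *\<^sub>C g i), (\<Sum>i\<in>F. c i *\<^sub>C h i)) | F c. finite F}"
  have RI: "((\<Sum>i\<in>F. c i *\<^sub>C g i), (\<Sum>i\<in>F. c i *\<^sub>C h i)) \<in> R" if "finite F" for F c
    using that by (auto simp: R_def)
  have R_add: "(x + x', y + y') \<in> R" if "(x, y) \<in> R" "(x', y') \<in> R" for x x' y y'
  proof -
    from that obtain F c F' c' where F: "finite F" "finite F'"
      and xy: "x = (\<Sum>i\<in>F. c i *\<^sub>C g i)" "y = (\<Sum>i\<in>F. c i *\<^sub>C h i)"
        "x' = (\<Sum>i\<in>F'. c' i *\<^sub>C g i)" "y' = (\<Sum>i\<in>F'. c' i *\<^sub>C h i)"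
      by (auto simp: R_def)
    define d where "d i = (if i \<in> F then c i else 0) + (if i \<in> F' then c' i else 0)" for i
    have eq: "(\<Sum>i\<in>F \<union> F'. d i *\<^sub>C f i) = (\<Sum>i\<in>F. c i *\<^sub>C f i) + (\<Sum>i\<in>F'. c' i *\<^sub>C f i)"
      for f :: "'i \<Rightarrow> 'c::complex_vector"
    proof -
      have "(\<Sum>i\<in>F \<union> F'. d i *\<^sub>C f i) = (\<Sum>i\<in>F \<union> F'. (if i \<in> F then c i else 0) *\<^sub>C f i)
          + (\<Sum>i\<in>F \<union> F'. (if i \<in> F' then c' i else 0) *\<^sub>C f i)"
        by (simp add: d_def scaleC_add_left sum.distrib)
      also have "\<dots> = (\<Sum>i\<in>F. c i *\<^sub>C f i) + (\<Sum>i\<in>F'. c' i *\<^sub>C f i)"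
        using F by (intro arg_cong2[of _ _ _ _ "(+)"] sum.mono_neutral_cong_right) auto
      finally show ?thesis .
    qed
    show ?thesis unfolding xy eq[symmetric] using F by (intro RI) simp
  qed
  have R_scale: "(a *\<^sub>C x, a *\<^sub>C y) \<in> R" if "(x, y) \<in> R" for a x y
  proof -
    from that obtain F c where F: "finite F" "x = (\<Sum>i\<in>F. c i *\<^sub>C g i)" "y = (\<Sum>i\<in>F. c i *\<^sub>C h i)"
      by (auto simp: R_def)
    then show ?thesis
      using RI[OF F(1), of "\<lambda>i. a * c i"]
      by (simp add: complex_vector.scale_sum_right scaleC_scaleC)
  qed
  have R_gen: "(g i, h i) \<in> R" for i using RI[of "{i}" "\<lambda>_. 1"] by (simp add: scaleC_one)
  have R_dom: "\<exists>y. (x, y) \<in> R" if "x \<in> cspan (range g)" for x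
    using that
  proof (induction rule: complex_vector.span_induct_alt)
    case base
    show ?case using RI[of "{}"] by auto
  next
    case (step a x y)
    then show ?case using R_add R_scale R_gen by blast
  qed
  define G where "G x y \<longleftrightarrow> (\<exists>X Y. (\<forall>n. (X n, Y n) \<in> R) \<and> X \<longlonglongrightarrow> x \<and> Y \<longlonglongrightarrow> y)" for x y
  have G_add: "G (x + x') (y + y')" if "G x y" "G x' y'" for x x' y y'
  proof -
    from that obtain X Y X' Y' where "\<forall>n. (X n, Y n) \<in> R" "X \<longlonglongrightarrow> x" "Y \<longlonglongrightarrow> y"
      "\<forall>n. (X' n, Y' n) \<in> R" "X' \<longlonglongrightarrow> x'" "Y' \<longlonglongrightarrow> y'" unfolding G_def by blast
    then show ?thesis unfolding G_def
      by (intro exI[of _ "\<lambda>n. X n + X' n"] exI[of _ "\<lambda>n. Y n + Y' n"]) (auto intro: R_add tendsto_add)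
  qed
  have G_scale: "G (a *\<^sub>C x) (a *\<^sub>C y)" if "G x y" for a x y
  proof -
    from that obtain X Y where "\<forall>n. (X n, Y n) \<in> R" "X \<longlonglongrightarrow> x" "Y \<longlonglongrightarrow> y" unfolding G_def by blast
    then show ?thesis unfolding G_def
      by (intro exI[of _ "\<lambda>n. a *\<^sub>C X n"] exI[of _ "\<lambda>n. a *\<^sub>C Y n"])
        (auto intro: R_scale bounded_linear.tendsto[OF bounded_linear_scaleC])
  qed
  have R_le: "norm y \<le> C * norm x" if "(x, y) \<in> R" for x y
    using that bound by (auto simp: R_def)
  have G_le: "norm y \<le> C * norm x" if G: "G x y" for x y
  proof -
    obtain X Y where XY: "\<forall>n. (X n, Y n) \<in> R" "X \<longlonglongrightarrow> x" "Y \<longlonglongrightarrow> y" using G unfolding G_def by blast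
    have "norm (Y n) \<le> C * norm (X n)" for n using R_le XY(1) by blast
    then show ?thesis
      using XY(2,3) by (intro LIMSEQ_le[OF tendsto_norm[OF XY(3)] tendsto_mult_left[OF tendsto_norm[OF XY(2)]]]) auto
  qed
  \<comment> \<open>The \<open>g i\<close> may be linearly dependent; the bound applied to a
    difference makes the extension single-valued all the same.\<close>
  have G_unique: "y = y'" if "G x y" "G x y'" for x y y'
  proof -
    have "G (x + (-1) *\<^sub>C x) (y + (-1) *\<^sub>C y')" by (intro G_add G_scale that)
    from G_le[OF this] show ?thesis by (simp add: scaleC_minus_one)
  qed
  have G_ex: "\<exists>y. G x y" if "x \<in> ?M" for x
  proof -
    obtain X where X: "\<And>n. X n \<in> cspan (range g)" "X \<longlonglongrightarrow> x"
      using \<open>x \<in> ?M\<close> unfolding closure_sequential by auto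
    obtain Y where Y: "\<And>n. (X n, Y n) \<in> R" using R_dom[OF X(1)] by metis
    have le: "norm (Y m - Y n) \<le> \<bar>C\<bar> * norm (X m - X n)" for m n
    proof -
      have "norm (Y m + (-1) *\<^sub>C Y n) \<le> C * norm (X m + (-1) *\<^sub>C X n)"
        by (intro R_le R_add R_scale Y)
      also have "\<dots> \<le> \<bar>C\<bar> * norm (X m + (-1) *\<^sub>C X n)" by (intro mult_right_mono) auto
      finally show ?thesis by (simp add: scaleC_minus_one)
    qed
    have "Cauchy Y"
    proof (rule metric_CauchyI)
      fix e :: real assume "0 < e"
      then have "0 < e / (\<bar>C\<bar> + 1)" by simp
      then obtain N where N: "\<And>m n. m \<ge> N \<Longrightarrow> n \<ge> N \<Longrightarrow> dist (X m) (X n) < e / (\<bar>C\<bar> + 1)"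
        using metric_CauchyD[OF LIMSEQ_imp_Cauchy[OF X(2)]] by metis
      have "dist (Y m) (Y n) < e" if "m \<ge> N" "n \<ge> N" for m n
      proof -
        have "norm (Y m - Y n) \<le> (\<bar>C\<bar> + 1) * norm (X m - X n)"
          using le[of m n] by (simp add: distrib_right add_increasing2)
        also have "\<dots> < e" using N[OF that] by (simp add: dist_norm field_simps)
        finally show ?thesis by (simp add: dist_norm)
      qed
      then show "\<exists>N. \<forall>m\<ge>N. \<forall>n\<ge>N. dist (Y m) (Y n) < e" by blast
    qed
    then obtain y where "Y \<longlonglongrightarrow> y" using Cauchy_convergent_iff convergent_def by blast
    then show ?thesis unfolding G_def using X Y by blast
  qed
  \<comment> \<open>Composing with the projection \<open>P\<close> onto the closed span defines the
    operator everywhere and makes it vanish on the orthogonal complement.\<close>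
  have "\<forall>y. \<exists>p. p \<in> ?M \<and> (\<forall>x\<in>?M. cinner x (y - p) = 0)"
    using orthogonal_projection[OF M] by metis
  from choice[OF this] obtain P
    where "\<forall>y. P y \<in> ?M \<and> (\<forall>x\<in>?M. cinner x (y - P y) = 0)" by blast
  then have P: "P y \<in> ?M" "x \<in> ?M \<Longrightarrow> cinner x (y - P y) = 0" for x y by auto
  have P_unique: "P y = p" if "p \<in> ?M" "\<And>x. x \<in> ?M \<Longrightarrow> cinner x (y - p) = 0" for y p
  proof -
    have d: "P y - p \<in> ?M" using P(1) that(1) by (intro complex_vector.subspace_diff[OF sub])
    have "cinner (P y - p) ((y - p) - (y - P y)) = 0"
      using P(2)[OF d, of y] that(2)[OF d] by (subst cinner_diff_right) simp
    then show ?thesis by (simp add: cinner_same)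
  qed
  have P_norm: "norm (P y) \<le> norm y" for y
  proof -
    have "(norm (P y + (y - P y)))\<^sup>2 = (norm (P y))\<^sup>2 + (norm (y - P y))\<^sup>2"
      unfolding norm_add_sq by (simp add: P)
    then have "(norm (P y))\<^sup>2 \<le> (norm y)\<^sup>2" by simp
    then show ?thesis by (simp add: power2_le_iff_abs_le)
  qed
  have P_id: "P y = y" if "y \<in> ?M" for y using that by (intro P_unique) auto
  obtain T where T: "\<And>x. G (P x) (T x)" using G_ex[OF P(1)] by metis
  have T_eq: "T x = y" if "G (P x) y" for x y using G_unique[OF T that] .
  have "bounded_clinear T"
  proof (rule bounded_clinearI)
    fix x y c
    have "P (x + y) = P x + P y"
    proof (rule P_unique)
      show "P x + P y \<in> ?M" by (intro complex_vector.subspace_add[OF sub] P)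
      show "cinner z (x + y - (P x + P y)) = 0" if "z \<in> ?M" for z
        using P(2)[OF that, of x] P(2)[OF that, of y] by (simp add: cinner_diff_right cinner_add_right)
    qed
    then show "T (x + y) = T x + T y" using G_add[OF T T] by (intro T_eq) simp
    have "P (c *\<^sub>C x) = c *\<^sub>C P x"
    proof (rule P_unique)
      show "c *\<^sub>C P x \<in> ?M" by (intro complex_vector.subspace_scale[OF sub] P)
      show "cinner z (c *\<^sub>C x - c *\<^sub>C P x) = 0" if "z \<in> ?M" for z
        using P(2)[OF that, of x] by (simp add: cinner_diff_right cinner_scaleC_right)
    qed
    then show "T (c *\<^sub>C x) = c *\<^sub>C T x" using G_scale[OF T] by (intro T_eq) simp
    have "norm (T x) \<le> C * norm (P x)" by (rule G_le[OF T])
    also have "\<dots> \<le> \<bar>C\<bar> * norm x" using P_norm by (intro mult_mono) auto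
    finally show "norm (T x) \<le> \<bar>C\<bar> * norm x" .
  qed
  moreover have "T (g i) = h i" for i
  proof (rule T_eq)
    have "g i \<in> ?M" using closure_subset complex_vector.span_superset by fastforce
    moreover have "G (g i) (h i)" unfolding G_def
      using R_gen[of i] by (intro exI[of _ "\<lambda>_. g i"] exI[of _ "\<lambda>_. h i"]) auto
    ultimately show "G (P (g i)) (h i)" by (simp add: P_id)
  qed
  moreover have "T x = 0" if *: "\<And>i. cinner (g i) x = 0" for x
  proof (rule T_eq)
    have "cinner z x = 0" if "z \<in> ?M" for z
    proof -
      have "cinner z x = 0" if "z \<in> cspan (range g)" for z
        using that by (induction rule: complex_vector.span_induct_alt)
          (auto simp: cinner_add_left cinner_scaleC_left *)
      moreover obtain X where "\<And>n. X n \<in> cspan (range g)" "X \<longlonglongrightarrow> z"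
        using \<open>z \<in> ?M\<close> unfolding closure_sequential by auto
      ultimately show ?thesis
        using bounded_linear.tendsto[OF bounded_linear_cinner_left, of X z sequentially x]
        by (simp add: LIMSEQ_const_iff)
    qed
    then have "P x = 0" using complex_vector.subspace_0[OF sub] by (intro P_unique) auto
    moreover have "G 0 0" unfolding G_def using RI[of "{}"]
      by (intro exI[of _ "\<lambda>_. 0"]) auto
    ultimately show "G (P x) 0" by simp
  qed
  ultimately show thesis using that by blast
qed

text \<open>Meant for operators built by extension from a family \<open>g\<close> that need not be
  total: on the complement of its closed span they are zero, so the last premise is immediate
  there.\<close>

lemma clinear_eq_on_generators:
  assumes S: "bounded_clinear S" and T: "bounded_clinear T" and gen: "\<And>i. S (g i) = T (g i)"
    and orth: "\<And>x. (\<And>i. cinner (g i) x = 0) \<Longrightarrow> S x = T x"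
  shows "S = (T :: 'a::chilbert_space \<Rightarrow> 'b::complex_inner)"
proof
  fix x
  have M: "closed_csubspace (closure (cspan (range g)))" by (rule closed_csubspace_closure_cspan)
  obtain p where p: "p \<in> closure (cspan (range g))"
    "\<And>z. z \<in> closure (cspan (range g)) \<Longrightarrow> cinner z (x - p) = 0"
    using orthogonal_projection[OF M, of x] by metis
  have "cinner (g i) (x - p) = 0" for i
    using closure_subset complex_vector.span_superset by (intro p(2)) fastforce
  then have "S (x - p) = T (x - p)" by (rule orth)
  moreover have "S p = T p" by (rule clinear_eq_on_cspan[OF S T gen p(1)])
  ultimately show "S x = T x" by (simp add: bounded_clinear_diff[OF S] bounded_clinear_diff[OF T])
qed

lemma clinear_eq_on_total:
  assumes "bounded_clinear S" "bounded_clinear T" "\<And>i. S (g i) = T (g i)"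
    and "\<And>x. (\<And>i. cinner (g i) x = 0) \<Longrightarrow> x = 0"
  shows "S = (T :: 'a::chilbert_space \<Rightarrow> 'b::complex_inner)"
proof (rule clinear_eq_on_generators[OF assms(1-3)])
  show "S x = T x" if "\<And>i. cinner (g i) x = 0" for x
    using assms(4)[OF that] by (simp add: bounded_clinear_zero assms(1,2))
qed

section \<open>Fuglede's theorem\<close>

lemma funpow_commute_at:
  "(\<And>x. f (g x) = g (f x)) \<Longrightarrow> (f ^^ n) (g x) = g ((f ^^ n) x)"
  by (induction n) simp_all

lemma funpow_comp_at:
  assumes "\<And>x. f (g x) = g (f x)"
  shows "(f ^^ n) ((g ^^ n) x) = ((\<lambda>x. f (g x)) ^^ n) x"
proof (induction n)
  case (Suc n)
  have "(f ^^ n) (g y) = g ((f ^^ n) y)" for y using assms by (rule funpow_commute_at)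
  then show ?case by (simp add: Suc.IH)
qed simp

lemma norm_funpow_le:
  fixes f :: "'a::real_normed_vector \<Rightarrow> 'a"
  assumes "\<And>x. norm (f x) \<le> b * norm x" "0 \<le> b"
  shows "norm ((f ^^ n) x) \<le> b ^ n * norm x"
proof (induction n)
  case (Suc n)
  have "norm (f ((f ^^ n) x)) \<le> b * norm ((f ^^ n) x)" by (rule assms)
  also have "\<dots> \<le> b * (b ^ n * norm x)" by (intro mult_left_mono Suc assms)
  finally show ?case by (simp add: ac_simps)
qed simp

text \<open>The \<open>n\<close>-th power of \<open>id_plus (z / n) T\<close> replaces
  \<open>exp (z T)\<close>: it has the same first-order term in \<open>z\<close> and is a
  polynomial, so no operator-valued series is involved.\<close>

definition id_plus :: "complex \<Rightarrow> ('a::complex_inner \<Rightarrow> 'a) \<Rightarrow> 'a \<Rightarrow> 'a" where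
  "id_plus c T x = x + c *\<^sub>C T x"

lemma bounded_clinear_id_plus: "bounded_clinear T \<Longrightarrow> bounded_clinear (id_plus c T)"
  unfolding id_plus_def[abs_def]
  by (intro bounded_clinear_fun_add bounded_clinear_ident bounded_clinear_fun_scaleC)

lemma norm_id_plus_le:
  assumes "\<And>x. norm (T x) \<le> a * norm x"
  shows "norm (id_plus c T x) \<le> (1 + cmod c * a) * norm x"
proof -
  have "norm (id_plus c T x) \<le> norm x + cmod c * norm (T x)"
    unfolding id_plus_def using norm_triangle_ineq[of x "c *\<^sub>C T x"] by (simp add: norm_scaleC)
  also have "\<dots> \<le> norm x + cmod c * (a * norm x)" by (intro add_left_mono mult_left_mono assms) simp
  finally show ?thesis by (simp add: algebra_simps)
qed

text \<open>Used with \<open>c\<close> of order \<open>1 / n^2\<close>, where the factor on the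
  right tends to 0 although the operator is iterated \<open>n\<close> times.\<close>

lemma norm_id_minus_funpow_le:
  assumes "\<And>x. norm (T x) \<le> a * norm x" "0 \<le> a"
  shows "norm (x - (id_plus c T ^^ n) x) \<le> ((1 + cmod c * a) ^ n - 1) * norm x"
proof (induction n)
  case (Suc n)
  let ?y = "(id_plus c T ^^ n) x"
  have y: "norm ?y \<le> (1 + cmod c * a) ^ n * norm x"
    by (rule norm_funpow_le[OF norm_id_plus_le[OF assms(1)]]) (simp add: assms)
  have "norm (x - (id_plus c T ^^ Suc n) x) = norm ((x - ?y) - c *\<^sub>C T ?y)"
    by (simp add: id_plus_def algebra_simps)
  also have "\<dots> \<le> norm (x - ?y) + cmod c * norm (T ?y)"
    using norm_triangle_ineq4[of "x - ?y" "c *\<^sub>C T ?y"] by (simp add: norm_scaleC)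
  also have "\<dots> \<le> ((1 + cmod c * a) ^ n - 1) * norm x + cmod c * (a * ((1 + cmod c * a) ^ n * norm x))"
  proof (intro add_mono Suc mult_left_mono)
    show "norm (T ?y) \<le> a * ((1 + cmod c * a) ^ n * norm x)"
      using assms(1)[of ?y] mult_left_mono[OF y assms(2)] by linarith
  qed simp
  finally show ?case by (simp add: algebra_simps)
qed simp

text \<open>Holomorphy is tested against single vectors, so that the scalar Cauchy inequality is
  enough; \<open>v\<close> and \<open>v'\<close> are the first two Taylor coefficients at 0.\<close>

definition weak_expansion :: "(complex \<Rightarrow> 'a::chilbert_space) \<Rightarrow> 'a \<Rightarrow> 'a \<Rightarrow> bool" where
  "weak_expansion F v v' \<longleftrightarrow> F 0 = v \<and> (\<forall>y. (\<lambda>z. cinner (F z) y) holomorphic_on UNIV \<and>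
     ((\<lambda>z. cinner (F z) y) has_field_derivative cinner v' y) (at 0))"

lemma weak_expansion_const: "weak_expansion (\<lambda>_. x) x 0"
  by (simp add: weak_expansion_def)

lemma weak_expansion_clinear:
  assumes "weak_expansion F v v'" and T: "bounded_clinear (T :: 'a::chilbert_space \<Rightarrow> 'a)"
  shows "weak_expansion (\<lambda>z. T (F z)) (T v) (T v')"
  using assms(1) unfolding weak_expansion_def by (auto simp: cinner_adj_right[OF T, symmetric])

lemma weak_expansion_id_plus:
  assumes F: "weak_expansion F v v'" and T: "bounded_clinear T"
  shows "weak_expansion (\<lambda>z. id_plus (z * s) T (F z)) v (v' + s *\<^sub>C T v)"
  unfolding weak_expansion_def
proof (intro conjI allI)
  show "id_plus (0 * s) T (F 0) = v" using F by (simp add: id_plus_def weak_expansion_def)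
  fix y
  have eq: "cinner (id_plus (z * s) T (F z)) y = cinner (F z) y + z * s * cinner (F z) (adj T y)" for z
    by (simp add: id_plus_def cinner_add_left cinner_scaleC_left cinner_adj_right[OF T])
  have hol: "(\<lambda>z. cinner (F z) w) holomorphic_on UNIV" for w using F by (simp add: weak_expansion_def)
  have der: "((\<lambda>z. cinner (F z) w) has_field_derivative cinner v' w) (at 0)" for w
    using F by (simp add: weak_expansion_def)
  show "(\<lambda>z. cinner (id_plus (z * s) T (F z)) y) holomorphic_on UNIV"
    unfolding eq by (intro holomorphic_intros hol)
  have F0: "F 0 = v" using F by (simp add: weak_expansion_def)
  show "((\<lambda>z. cinner (id_plus (z * s) T (F z)) y) has_field_derivative
      cinner (v' + s *\<^sub>C T v) y) (at 0)"
    unfolding eq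
    by (rule derivative_eq_intros der | (simp add: F0 cinner_add_left cinner_scaleC_left cinner_adj_right[OF T]; fail))+
qed

lemma weak_expansion_funpow:
  assumes F: "weak_expansion F v v'" and T: "bounded_clinear T"
  shows "weak_expansion (\<lambda>z. (id_plus (z * s) T ^^ n) (F z)) v (v' + (of_nat n * s) *\<^sub>C T v)"
proof (induction n)
  case (Suc n)
  from weak_expansion_id_plus[OF Suc T, of s] show ?case
    by (simp add: algebra_simps scaleC_add_left)
qed (simp add: F)

lemma normal_op_bounded_clinear: "normal_op N \<Longrightarrow> bounded_clinear N"
  by (simp add: normal_op_def)

lemma normal_op_adj_commute: "normal_op N \<Longrightarrow> adj N (N x) = N (adj N x)"
  by (auto simp: normal_op_def fun_eq_iff)

context
  fixes N :: "'a::chilbert_space \<Rightarrow> 'a"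
  assumes normal: "normal_op N"
begin

private lemmas N = normal_op_bounded_clinear[OF normal]
private lemmas M = bounded_clinear_adj[OF N]
private lemmas NM = normal_op_adj_commute[OF normal]

text \<open>The two operators are adjoints of each other and normal, and a normal operator and its
  adjoint have equal norms on every vector.\<close>

lemma norm_id_plus_adj: "norm (id_plus c (adj N) x) = norm (id_plus (cnj c) N x)"
proof -
  have "cinner x (cnj c *\<^sub>C N x) = cnj (cinner x (c *\<^sub>C adj N x))"
    using cinner_commute[of x "N x"] by (simp add: cinner_scaleC_right cinner_adj_right[OF N])
  then have "(norm (id_plus c (adj N) x))\<^sup>2 = (norm (id_plus (cnj c) N x))\<^sup>2"
    unfolding id_plus_def norm_add_sq by (simp add: norm_scaleC normal_op_norm_adj[OF normal])
  then show ?thesis by simp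
qed

lemma id_plus_id_minus: "id_plus c N (id_plus (- c) N x) = id_plus (- c\<^sup>2) (N \<circ> N) x"
  by (simp add: id_plus_def bounded_clinear_add[OF N] bounded_clinear_scaleC[OF N] scaleC_add_right
      scaleC_scaleC power2_eq_square bounded_clinear_diff[OF N] complex_vector.scale_right_diff_distrib)

text \<open>This product agrees to first order in \<open>c\<close> with the unitary operator
  \<open>exp (c *\<^sub>C adj N - cnj c *\<^sub>C N)\<close> of Rosenblum's proof, and thus replaces the operator exponential.\<close>

lemma norm_id_plus_adj_id_minus_le:
  assumes a: "\<And>x. norm (N x) \<le> a * norm x" "0 \<le> a"
  shows "norm (id_plus c (adj N) (id_plus (- cnj c) N x)) \<le> (1 + (cmod c * a)\<^sup>2) * norm x"
proof -
  have NN: "norm ((N \<circ> N) x) \<le> a\<^sup>2 * norm x" for x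
    using a(1)[of "N x"] mult_left_mono[OF a(1)[of x] a(2)] by (simp add: power2_eq_square)
  have "norm (id_plus c (adj N) (id_plus (- cnj c) N x)) = norm (id_plus (- (cnj c)\<^sup>2) (N \<circ> N) x)"
    by (simp add: norm_id_plus_adj id_plus_id_minus)
  also have "\<dots> \<le> (1 + cmod (- (cnj c)\<^sup>2) * a\<^sup>2) * norm x" by (rule norm_id_plus_le[OF NN])
  finally show ?thesis by (simp add: norm_power power_mult_distrib)
qed

text \<open>Since \<open>A\<close> commutes with \<open>N\<close>, the factors
  \<open>id_plus (- cnj c) N\<close> and \<open>id_plus (cnj c) N\<close> can be put on its two
  sides at the price of their product, which differs from the identity only by
  \<open>(cnj c)^2\<close>. The outer factors then pair up to the almost contractive
  \<open>u\<close> and \<open>v\<close>, which give the first summand of the bound; the price gives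
  the second.\<close>

lemma fuglede_estimate:
  assumes A: "bounded_clinear A" and comm: "\<And>x. A (N x) = N (A x)"
    and a: "\<And>x. norm (N x) \<le> a * norm x" "0 \<le> a" and K: "\<And>x. norm (A x) \<le> K * norm x" "0 \<le> K"
  shows "norm ((id_plus c (adj N) ^^ n) (A ((id_plus (- c) (adj N) ^^ n) x)))
    \<le> K * norm x * ((1 + (cmod c * a)\<^sup>2) ^ (2 * n) + (1 + cmod c * a) ^ (2 * n) * ((1 + (cmod c * a)\<^sup>2) ^ n - 1))"
proof -
  let ?M = "adj N"
  let ?e = "1 + (cmod c * a)\<^sup>2" and ?b = "1 + cmod c * a"
  define u where "u y = id_plus c ?M (id_plus (- cnj c) N y)" for y
  define v where "v y = id_plus (- c) ?M (id_plus (cnj c) N y)" for y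
  define w where "w = (id_plus (- c) ?M ^^ n) x"
  define S where "S = id_plus (- (cnj c)\<^sup>2) (N \<circ> N)"
  have MN_comm: "id_plus d ?M (id_plus d' N y) = id_plus d' N (id_plus d ?M y)" for d d' y
    by (simp add: id_plus_def bounded_clinear_add[OF N] bounded_clinear_scaleC[OF N]
        bounded_clinear_add[OF M] bounded_clinear_scaleC[OF M] NM scaleC_add_right scaleC_scaleC
        mult.commute add.assoc add.left_commute)
  have NN_comm: "id_plus d N (id_plus d' N y) = id_plus d' N (id_plus d N y)" for d d' y
    by (simp add: id_plus_def bounded_clinear_add[OF N] bounded_clinear_scaleC[OF N]
        scaleC_add_right scaleC_scaleC mult.commute add.assoc add.left_commute)
  have A_comm: "id_plus d N (A y) = A (id_plus d N y)" for d y
    by (simp add: id_plus_def bounded_clinear_add[OF A] bounded_clinear_scaleC[OF A] comm)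
  have Ma: "norm (?M y) \<le> a * norm y" for y using a(1) by (simp add: normal_op_norm_adj[OF normal])
  have u_le: "norm (u y) \<le> ?e * norm y" for y
    unfolding u_def by (rule norm_id_plus_adj_id_minus_le[OF a])
  have v_le: "norm (v y) \<le> ?e * norm y" for y
    using norm_id_plus_adj_id_minus_le[OF a, of "- c" y] by (simp add: v_def)
  have M_le: "norm ((id_plus d ?M ^^ n) y) \<le> (1 + cmod d * a) ^ n * norm y" for d y
    by (rule norm_funpow_le[OF norm_id_plus_le[OF Ma]]) (simp add: a(2))
  have NN: "norm ((N \<circ> N) y) \<le> a\<^sup>2 * norm y" for y
    using a(1)[of "N y"] mult_left_mono[OF a(1)[of y] a(2)] by (simp add: power2_eq_square)
  have e1: "?e \<ge> 1" and b1: "?b \<ge> 1" using a(2) by auto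
  have v_pow: "(v ^^ n) x = (id_plus (cnj c) N ^^ n) w"
  proof -
    have "(v ^^ n) x = ((\<lambda>y. id_plus (cnj c) N (id_plus (- c) ?M y)) ^^ n) x"
      unfolding v_def[abs_def] MN_comm ..
    then show ?thesis 
      using funpow_comp_at[of "id_plus (cnj c) N" "id_plus (- c) ?M", OF MN_comm[symmetric], of n x]
      by (simp only: w_def)
  qed
  have "(u ^^ n) (A ((v ^^ n) x))
      = (id_plus c ?M ^^ n) ((id_plus (- cnj c) N ^^ n) ((id_plus (cnj c) N ^^ n) (A w)))"
    unfolding v_pow u_def[abs_def]
    using funpow_comp_at[of "id_plus c ?M" "id_plus (- cnj c) N", OF MN_comm]
      funpow_commute_at[of "id_plus (cnj c) N" A, OF A_comm] by simp
  \<comment> \<open>\<open>S\<close> depends on \<open>c\<close> quadratically, so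
    \<open>S ^^ n\<close> is close to the identity when \<open>c\<close> is of order
    \<open>1 / n\<close>.\<close>
  also have "\<dots> = (id_plus c ?M ^^ n) ((S ^^ n) (A w))"
    using funpow_comp_at[of "id_plus (- cnj c) N" "id_plus (cnj c) N", OF NN_comm]
    by (simp add: S_def NN_comm[of "- cnj c" "cnj c"] id_plus_id_minus)
  finally have q: "(id_plus c ?M ^^ n) ((S ^^ n) (A w)) = (u ^^ n) (A ((v ^^ n) x))" ..
  have "norm ((u ^^ n) (A ((v ^^ n) x))) \<le> ?e ^ n * (K * (?e ^ n * norm x))"
  proof -
    have "norm ((u ^^ n) (A ((v ^^ n) x))) \<le> ?e ^ n * norm (A ((v ^^ n) x))"
      by (rule norm_funpow_le[OF u_le]) (use e1 in simp)
    also have "\<dots> \<le> ?e ^ n * (K * norm ((v ^^ n) x))" using e1 by (intro mult_left_mono K) simp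
    also have "\<dots> \<le> ?e ^ n * (K * (?e ^ n * norm x))"
      using e1 by (intro mult_left_mono norm_funpow_le[OF v_le] K(2)) simp_all
    finally show ?thesis .
  qed
  moreover have "norm ((id_plus c ?M ^^ n) (A w - (S ^^ n) (A w)))
      \<le> ?b ^ n * ((?e ^ n - 1) * (K * (?b ^ n * norm x)))"
  proof -
    have S_le: "norm (y - (S ^^ n) y) \<le> (?e ^ n - 1) * norm y" for y
      using norm_id_minus_funpow_le[where T = "N \<circ> N" and a = "a\<^sup>2" and c = "- (cnj c)\<^sup>2", OF NN]
      by (simp add: S_def norm_power power_mult_distrib)
    have "norm (A w) \<le> K * (?b ^ n * norm x)"
      using K(1)[of w] mult_left_mono[OF M_le[of "- c" x] K(2)] by (simp add: w_def)
    moreover have "?e ^ n - 1 \<ge> 0" using e1 by simp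
    ultimately have "norm (A w - (S ^^ n) (A w)) \<le> (?e ^ n - 1) * (K * (?b ^ n * norm x))"
      using S_le[of "A w"] by (meson mult_left_mono order_trans)
    then show ?thesis using M_le[of c "A w - (S ^^ n) (A w)"] b1
      by (smt (verit) mult_left_mono zero_le_power)
  qed
  moreover have "(id_plus c ?M ^^ n) (A w)
      = (u ^^ n) (A ((v ^^ n) x)) + (id_plus c ?M ^^ n) (A w - (S ^^ n) (A w))"
    unfolding q[symmetric] bounded_clinear_diff[OF bounded_clinear_funpow[OF bounded_clinear_id_plus[OF M]]]
    by simp
  ultimately have "norm ((id_plus c ?M ^^ n) (A w))
      \<le> ?e ^ n * (K * (?e ^ n * norm x)) + ?b ^ n * ((?e ^ n - 1) * (K * (?b ^ n * norm x)))"
    by (simp only:) (rule order_trans[OF norm_triangle_ineq add_mono])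
  then show ?thesis
    unfolding mult_2 power_add by (simp add: w_def algebra_simps)
qed

text \<open>For \<open>c = z / n\<close> the conjugated operator applied to \<open>x\<close> is a
  polynomial in \<open>z\<close> whose derivative at 0 is the commutator \<open>D\<close>. On the
  circle of radius \<open>r\<close> its norm is bounded by a quantity tending to
  \<open>K * norm x\<close> as \<open>n\<close> grows, whatever \<open>r\<close> is. The Cauchy
  inequality and large \<open>r\<close> then force \<open>D = 0\<close>, as in Liouville's
  theorem.\<close>

theorem fuglede:
  assumes A: "bounded_clinear A" and comm: "\<And>x. A (N x) = N (A x)"
  shows "A (adj N x) = adj N (A x)"
proof -
  obtain a where a: "0 < a" "\<And>x. norm (N x) \<le> a * norm x" using bounded_clinear_pos_bound[OF N] by blast
  obtain K where K: "0 < K" "\<And>x. norm (A x) \<le> K * norm x" using bounded_clinear_pos_bound[OF A] by blast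
  define D where "D = adj N (A x) - A (adj N x)"
  \<comment> \<open>The preceding estimate at \<open>cmod c = r / n\<close>, with
    \<open>(1 + y) ^ m\<close> replaced by \<open>exp (m y)\<close>.\<close>
  define B where "B r n = K * norm x * (exp (2 * (r * a)\<^sup>2 / real n)
      + exp (2 * (r * a)) * (exp ((r * a)\<^sup>2 / real n) - 1))" for r :: real and n
  have bound: "norm D * r \<le> B r n" if "0 < r" "0 < n" for r :: real and n
  proof -
    define s :: complex where "s = 1 / of_nat n"
    define F where "F z = (id_plus (z * s) (adj N) ^^ n) (A ((id_plus (z * (- s)) (adj N) ^^ n) x))" for z
    have ns: "of_nat n * s = 1" using that by (simp add: s_def)
    have "weak_expansion F (A x) (A (0 + (of_nat n * (- s)) *\<^sub>C adj N x) + (of_nat n * s) *\<^sub>C adj N (A x))"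
      unfolding F_def[abs_def]
      by (rule weak_expansion_funpow[OF weak_expansion_clinear[OF weak_expansion_funpow[OF
              weak_expansion_const M] A] M])
    then have "weak_expansion F (A x) D"
      using ns by (simp add: D_def scaleC_one bounded_clinear_minus[OF A] scaleC_minus_one)
    then have hol: "(\<lambda>z. cinner (F z) D) holomorphic_on UNIV"
      and der: "((\<lambda>z. cinner (F z) D) has_field_derivative cinner D D) (at 0)"
      by (auto simp: weak_expansion_def)
    have F_le: "norm (F z) \<le> B r n" if z: "cmod z = r" for z
    proof -
      have cs: "cmod (z * s) * a = r * a / n" using z \<open>0 < n\<close> by (simp add: s_def norm_mult norm_divide)
      have "norm (F z) \<le> K * norm x * ((1 + (r * a / n)\<^sup>2) ^ (2 * n)
          + (1 + r * a / n) ^ (2 * n) * ((1 + (r * a / n)\<^sup>2) ^ n - 1))"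
        using fuglede_estimate[where c = "z * s" and n = n and x = x, OF A comm a(2) _ K(2)] a(1) K(1)
        unfolding cs F_def by simp
      also have "\<dots> \<le> B r n"
        unfolding B_def
      proof (intro mult_left_mono add_mono mult_mono diff_right_mono)
        have pow: "(1 + y) ^ m \<le> exp (real m * y)" if "0 \<le> y" for y :: real and m
          using power_mono[OF exp_ge_add_one_self[of y], of m] that by (simp add: exp_of_nat_mult)
        have e: "real (2 * n) * (r * a / n)\<^sup>2 = 2 * (r * a)\<^sup>2 / real n"
          "real n * (r * a / n)\<^sup>2 = (r * a)\<^sup>2 / real n" "real (2 * n) * (r * a / n) = 2 * (r * a)"
          using \<open>0 < n\<close> by (simp_all add: power2_eq_square field_simps)
        show "(1 + (r * a / n)\<^sup>2) ^ (2 * n) \<le> exp (2 * (r * a)\<^sup>2 / real n)"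
          by (rule pow[of "(r * a / n)\<^sup>2" "2 * n", unfolded e]) simp
        show "(1 + (r * a / n)\<^sup>2) ^ n \<le> exp ((r * a)\<^sup>2 / real n)"
          by (rule pow[of "(r * a / n)\<^sup>2" n, unfolded e]) simp
        show "(1 + r * a / n) ^ (2 * n) \<le> exp (2 * (r * a))"
          by (rule pow[of "r * a / n" "2 * n", unfolded e]) (use \<open>0 < r\<close> a(1) in simp)
      qed (use K(1) in auto)
      finally show ?thesis .
    qed
    have "norm ((deriv ^^ 1) (\<lambda>z. cinner (F z) D) 0) \<le> fact 1 * (B r n * norm D) / r ^ 1"
    proof (rule Cauchy_inequality)
      show "(\<lambda>z. cinner (F z) D) holomorphic_on ball 0 r"
        using hol by (rule holomorphic_on_subset) simp
      show "continuous_on (cball 0 r) (\<lambda>z. cinner (F z) D)"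
        using holomorphic_on_imp_continuous_on[OF hol] by (rule continuous_on_subset) simp
      show "norm (cinner (F z) D) \<le> B r n * norm D" if "norm (0 - z) = r" for z
        using cmod_cinner_le[of "F z" D] mult_right_mono[OF F_le, of z "norm D"] that by simp
    qed (rule \<open>0 < r\<close>)
    then have "norm D * (norm D * r) \<le> norm D * B r n"
      using DERIV_imp_deriv[OF der] \<open>0 < r\<close>
      by (simp add: cinner_same norm_power norm_mult power2_eq_square field_simps)
    moreover have "0 \<le> B r n"
      by (rule order_trans[OF norm_ge_zero F_le[of "of_real r"]]) (use \<open>0 < r\<close> in simp)
    ultimately show ?thesis by (cases "D = 0") auto
  qed
  \<comment> \<open>The order of limits matters: \<open>n\<close> goes to infinity at fixed
    \<open>r\<close>, and only afterwards \<open>r\<close> is enlarged; the factor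
    \<open>exp (2 * (r * a))\<close> would not survive the other order.\<close>
  have D_le: "norm D * r \<le> K * norm x" if "0 < r" for r :: real
  proof (rule tendsto_lowerbound)
    show "(\<lambda>n. B r n) \<longlonglongrightarrow> K * norm x"
    proof -
      have "(\<lambda>n. B r n) \<longlonglongrightarrow> K * norm x * (exp 0 + exp (2 * (r * a)) * (exp 0 - 1))"
        unfolding B_def by (intro tendsto_intros lim_const_over_n)
      then show ?thesis by simp
    qed
    show "\<forall>\<^sub>F n in sequentially. norm D * r \<le> B r n"
      using eventually_gt_at_top[of 0] by eventually_elim (rule bound[OF that])
  qed simp
  have "D = 0"
  proof (rule ccontr)
    assume "D \<noteq> 0"
    then show False
      using D_le[of "K * norm x / norm D + 1"] K(1) by (simp add: distrib_left add_nonneg_pos)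
  qed
  then show ?thesis by (simp add: D_def)
qed

end

section \<open>Moments of commuting normal operators\<close>

text \<open>Moving one \<open>N\<close> across the inner product leaves \<open>adj N (N x)\<close>,
  and normality allows \<open>N (N x)\<close> in its place. This is the source of log-convexity in
  the second variable.\<close>

lemma normal_op_norm_sq_le:
  assumes N: "normal_op N"
  shows "(norm (N x))\<^sup>2 \<le> norm (N (N x)) * norm (x::'a::chilbert_space)"
proof -
  have cl: "bounded_clinear N" using N by (simp add: normal_op_def)
  have "(norm (N x))\<^sup>2 = Re (cinner (adj N (N x)) x)"
    by (simp add: norm_sq_eq_Re_cinner cinner_adj_left[OF cl])
  also have "\<dots> \<le> norm (adj N (N x)) * norm x" by (rule Re_cinner_le)
  finally show ?thesis by (simp add: normal_op_norm_adj[OF N])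
qed

text \<open>In a spectral representation of \<open>N\<close> this is multiplication by
  \<open>1 - t\<close> with \<open>t\<close> the squared modulus of the variable.\<close>

definition gap :: "('a::chilbert_space \<Rightarrow> 'a) \<Rightarrow> 'a \<Rightarrow> 'a" where
  "gap N x = x - adj N (N x)"

text \<open>Spectrally, the integral of \<open>(1 - t) ^ n * t ^ k\<close> against the distribution
  of \<open>t\<close> at the vector \<open>y\<close>.\<close>

definition gap_moment :: "('a::chilbert_space \<Rightarrow> 'a) \<Rightarrow> 'a \<Rightarrow> nat \<Rightarrow> nat \<Rightarrow> real" where
  "gap_moment N y n k = Re (cinner ((gap N ^^ n) (((\<lambda>x. adj N (N x)) ^^ k) y)) y)"

context
  fixes N :: "'a::chilbert_space \<Rightarrow> 'a"
  assumes normal: "normal_op N"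
begin

private lemmas bounded = normal_op_bounded_clinear[OF normal]
private lemmas commute = normal_op_adj_commute[OF normal]


lemma bounded_clinear_gap: "bounded_clinear (gap N)"
  unfolding gap_def[abs_def]
  by (intro bounded_clinear_fun_diff bounded_clinear_ident bounded_clinear_compose[of "adj N" N]
      bounded_clinear_adj bounded)

lemma cinner_gap: "cinner (gap N x) y = cinner x (gap N y)"
  by (simp add: gap_def cinner_diff_left cinner_diff_right cinner_adj_left[OF bounded] cinner_adj_right[OF bounded])

lemma cinner_gap_funpow: "cinner ((gap N ^^ n) x) y = cinner x ((gap N ^^ n) y)"
  by (induction n arbitrary: x y) (simp_all add: cinner_gap funpow_swap1)


lemma gap_moment_Suc: "gap_moment N y (Suc n) k = gap_moment N y n k - gap_moment N y n (Suc k)"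
proof -
  let ?P = "(\<lambda>x. adj N (N x)) ^^ k"
  have "(gap N ^^ Suc n) (?P y) = (gap N ^^ n) (gap N (?P y))" by (simp add: funpow_swap1)
  also have "\<dots> = (gap N ^^ n) (?P y) - (gap N ^^ n) (adj N (N (?P y)))"
    unfolding gap_def[of N "?P y"] by (rule bounded_clinear_diff[OF bounded_clinear_funpow[OF bounded_clinear_gap]])
  finally show ?thesis by (simp add: gap_moment_def cinner_diff_left)
qed

lemma gap_moment_0: "gap_moment N y 0 k = (norm ((N ^^ k) y))\<^sup>2"
proof -
  have "((\<lambda>x. adj N (N x)) ^^ k) y = (adj N ^^ k) ((N ^^ k) y)"
    by (rule funpow_comp_at[of "adj N" N, OF commute, symmetric])
  then show ?thesis
    by (simp add: gap_moment_def adj_funpow[OF bounded] cinner_adj_left[OF bounded_clinear_funpow[OF bounded]]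
        norm_sq_eq_Re_cinner)
qed

lemma gap_moment_even: "gap_moment N y (n + n) 0 = (norm ((gap N ^^ n) y))\<^sup>2"
  by (simp add: gap_moment_def funpow_add cinner_gap_funpow norm_sq_eq_Re_cinner)

text \<open>The moments are those of the density \<open>t powr (p / q - 1) / q\<close> on the unit
  interval, and the result is the Beta integral of \<open>(1 - t) ^ (2 n)\<close> against it. It is
  obtained here by iterated differences in \<open>k\<close>; \<open>gap N\<close> is self-adjoint,
  which doubles the exponent.\<close>

lemma norm_gap_funpow:
  assumes moments: "\<And>k. (norm ((N ^^ k) y))\<^sup>2 = 1 / (p + q * real k)" and "0 < p" "0 < q"
  shows "(norm ((gap N ^^ n) y))\<^sup>2 = fact (n + n) / (q * pochhammer (p / q) (n + n + 1))"
proof -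
  have "gap_moment N y m k = fact m * q ^ m / (\<Prod>i\<le>m. p + q * real (k + i))" for m k
  proof (induction m arbitrary: k)
    case 0
    then show ?case by (simp add: gap_moment_0 moments)
  next
    case (Suc m)
    define D where "D = (\<Prod>i<Suc m. p + q * real (Suc k + i))"
    define f l where "f = p + q * real k" and "l = p + q * real (Suc (k + m))"
    have pos: "p + q * real j > 0" for j using \<open>0 < p\<close> \<open>0 < q\<close> by (simp add: add_pos_nonneg)
    have fl: "f > 0" "l > 0" unfolding f_def l_def by (rule pos)+
    \<comment> \<open>The denominators at \<open>k\<close> and \<open>Suc k\<close> share the middle
      factors \<open>C\<close>, so the difference of the two fractions has numerator
      \<open>l - f = q * real (Suc m)\<close>.\<close>
    define C where "C = (\<Prod>i<m. p + q * real (Suc k + i))"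
    have "C > 0" unfolding C_def by (intro prod_pos ballI pos)
    have P0: "(\<Prod>i\<le>m. p + q * real (k + i)) = f * C"
      by (simp add: C_def f_def lessThan_Suc_atMost[symmetric] prod.lessThan_Suc_shift add_ac del: prod.lessThan_Suc)
    have P1: "(\<Prod>i\<le>m. p + q * real (Suc k + i)) = C * l"
      by (simp add: C_def l_def lessThan_Suc_atMost[symmetric])
    have P2: "(\<Prod>i\<le>Suc m. p + q * real (k + i)) = f * C * l"
      unfolding prod.atMost_Suc P0 by (simp add: l_def)
    have "gap_moment N y (Suc m) k = fact m * q ^ m * (l - f) / (f * C * l)"
      unfolding gap_moment_Suc Suc P0 P1 using fl \<open>C > 0\<close> by (simp add: field_simps)
    also have "l - f = q * real (Suc m)" by (simp add: l_def f_def algebra_simps)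
    finally show ?case unfolding P2 by (simp add: mult_ac)
  qed
  then have "(norm ((gap N ^^ n) y))\<^sup>2 = fact (n + n) * q ^ (n + n) / (\<Prod>i\<le>n+n. p + q * real i)"
    unfolding gap_moment_even[symmetric] by simp
  also have "(\<Prod>i\<le>n+n. p + q * real i) = (\<Prod>i\<le>n+n. q * (p / q + real i))"
    using \<open>0 < q\<close> by (intro prod.cong) (simp_all add: field_simps)
  also have "\<dots> = q ^ (n + n) * (q * pochhammer (p / q) (n + n + 1))"
    by (simp add: prod.distrib pochhammer_Suc_prod atLeast0AtMost mult_ac)
  finally show ?thesis using \<open>0 < q\<close> by simp
qed

end

text \<open>The measure of the pair has the first marginal density proportional to
  \<open>t powr (r l - 1)\<close> after weighting with the \<open>l\<close>-th power of the second variable, so Cauchy-Schwarz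
  against \<open>(1 - t) ^ n\<close> with \<open>n\<close> large fails when the exponents \<open>r l\<close> are strictly convex in \<open>l\<close>.\<close>

lemma moment_coefficients_of_normal_pair:
  fixes N1 N2 :: "'a::chilbert_space \<Rightarrow> 'a"
  assumes normal: "normal_op N1" "normal_op N2" and comm: "\<And>x. N1 (N2 x) = N2 (N1 x)"
    and moments: "\<And>k l. (norm ((N1 ^^ k) ((N2 ^^ l) x)))\<^sup>2
      = 1 / (1 + a * real k + b * real l + c * real k * real l)"
    and nonneg: "0 \<le> a" "0 \<le> b" "0 < c"
  shows "c \<le> a * b"
proof (rule ccontr)
  assume "\<not> c \<le> a * b"
  then have ab: "a * b < c" by simp
  define p q r where "p l = 1 + b * real l" and "q l = a + c * real l" and "r l = p l / q l" for l
  have p: "p l > 0" for l using nonneg by (simp add: p_def add_pos_nonneg)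
  have q: "q l > 0" if "l > 0" for l using nonneg that by (simp add: q_def add_nonneg_pos)
  have r: "r l > 0" if "l > 0" for l using p q that by (simp add: r_def)
  define E where "E l n = (norm ((gap N1 ^^ n) ((N2 ^^ l) x)))\<^sup>2" for l n
  have E: "E l n = fact (n + n) / (q l * pochhammer (r l) (n + n + 1))" if "l > 0" for l n
    unfolding E_def r_def
  proof (rule norm_gap_funpow[OF normal(1)])
    show "(norm ((N1 ^^ k) ((N2 ^^ l) x)))\<^sup>2 = 1 / (p l + q l * real k)" for k
      unfolding moments by (simp add: p_def q_def algebra_simps)
  qed (use p q that in auto)
  have "bounded_clinear N2" using normal(2) by (simp add: normal_op_def)
  \<comment> \<open>\<open>gap N1\<close> contains \<open>adj N1\<close>, so commuting it past
    \<open>N2\<close> takes Fuglede's theorem.\<close>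
  then have adj_comm: "N2 (adj N1 y) = adj N1 (N2 y)" for y
    by (rule fuglede[OF normal(1)]) (simp add: comm)
  have gap_comm: "gap N1 (N2 y) = N2 (gap N1 y)" for y
    by (simp add: gap_def adj_comm comm bounded_clinear_diff[OF \<open>bounded_clinear N2\<close>])
  have E_eq: "E l n = (norm ((N2 ^^ l) ((gap N1 ^^ n) x)))\<^sup>2" for l n
  proof -
    have "(gap N1 ^^ n) (N2 y) = N2 ((gap N1 ^^ n) y)" for y using gap_comm by (rule funpow_commute_at)
    from funpow_commute_at[of N2 "gap N1 ^^ n", OF this[symmetric]] show ?thesis by (simp add: E_def)
  qed
  \<comment> \<open>The orders 1, 2, 3 replace 0, 1, 2 because \<open>q 0 = a\<close> may vanish,
    and then \<open>r 0\<close> is not an exponent.\<close>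
  have logconvex: "(E 2 n)\<^sup>2 \<le> E 1 n * E 3 n" for n
  proof -
    define z where "z = N2 ((gap N1 ^^ n) x)"
    have "((norm (N2 z))\<^sup>2)\<^sup>2 \<le> (norm (N2 (N2 z)) * norm z)\<^sup>2"
      by (intro power_mono normal_op_norm_sq_le normal) simp
    then show ?thesis by (simp add: E_eq z_def power_mult_distrib numeral_2_eq_2 numeral_3_eq_3)
        (simp add: power2_eq_square mult_ac)
  qed
  \<comment> \<open>Gauss's product for Gamma: splitting off the power
    \<open>(2 n) powr (- r l)\<close> leaves a factor that converges to
    \<open>Gamma (r l)\<close>.\<close>
  define G where "G l n = Gamma_series (r l) (n + n)" for l n
  have EG: "E l n = G l n * exp (- (r l * ln (real (n + n)))) / q l" if "l > 0" for l n
    unfolding E[OF that] G_def Gamma_series_def by (simp add: exp_minus field_simps)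
  have Gpos: "G l n > 0" if "l > 0" for l n
    unfolding G_def Gamma_series_def using r[OF that] by (simp add: pochhammer_pos)
  \<comment> \<open>Second difference of the exponents. As
    \<open>r l = b / c + (1 - a * b / c) / q l\<close>, it has the sign of
    \<open>c - a * b\<close>.\<close>
  define \<eta> where "\<eta> = r 1 + r 3 - 2 * r 2"
  have eta: "\<eta> > 0"
  proof -
    have q123: "q 1 > 0" "q 2 > 0" "q 3 > 0" using q by simp_all
    have "\<eta> = 2 * c * (c - a * b) / (q 1 * q 2 * q 3)"
      using q123 unfolding \<eta>_def r_def
      by (simp add: divide_simps) (simp add: p_def q_def algebra_simps)
    then show ?thesis using q123 ab nonneg by simp
  qed
  \<comment> \<open>This is \<open>E 1 n * E 3 n / (E 2 n)^2\<close>: at least 1 by log-convexity,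
    while its last factor tends to 0 and the others have finite limits.\<close>
  define R where "R n = (G 1 n * G 3 n / (G 2 n)\<^sup>2) * ((q 2)\<^sup>2 / (q 1 * q 3)) * exp (- (\<eta> * ln (real (n + n))))" for n
  have R1: "R n \<ge> 1" for n
  proof -
    have e: "exp (- (\<eta> * ln (real (n + n)))) = exp (- (r 1 * ln (real (n + n)))) * exp (- (r 3 * ln (real (n + n))))
        / (exp (- (r 2 * ln (real (n + n)))))\<^sup>2"
      by (simp add: \<eta>_def algebra_simps flip: exp_add exp_diff exp_double)
    have "R n = E 1 n * E 3 n / (E 2 n)\<^sup>2"
      unfolding R_def e
      using Gpos[of 2 n] q[of 1] q[of 2] q[of 3]
      by (simp add: EG power_divide power_mult_distrib mult_ac)
    moreover have "E 2 n > 0" using Gpos[of 2 n] q[of 2] by (simp add: EG)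
    ultimately show ?thesis using logconvex[of n] by simp
  qed
  have lim_nn: "filterlim (\<lambda>n::nat. n + n) at_top sequentially"
    by (rule filterlim_at_top_mono[OF filterlim_ident]) simp
  have G_lim: "(\<lambda>n. G l n) \<longlonglongrightarrow> Gamma (r l)" for l
    unfolding G_def by (rule filterlim_compose[OF Gamma_series_LIMSEQ lim_nn])
  have "Gamma (r 2) \<noteq> 0" using r[of 2] nonpos_Ints_nonpos[of "r 2"] by (auto simp: Gamma_eq_zero_iff)
  moreover have "(\<lambda>n. exp (- (\<eta> * ln (real (n + n))))) \<longlonglongrightarrow> 0"
  proof -
    have "filterlim (\<lambda>n. \<eta> * ln (real (n + n))) at_top sequentially"
      by (intro filterlim_tendsto_pos_mult_at_top[OF tendsto_const eta]
          filterlim_compose[OF ln_at_top] filterlim_compose[OF filterlim_real_sequentially lim_nn])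
    then show ?thesis
      by (intro filterlim_compose[OF exp_at_bot]) (simp add: filterlim_uminus_at_bot)
  qed
  ultimately have "R \<longlonglongrightarrow> (Gamma (r 1) * Gamma (r 3) / (Gamma (r 2))\<^sup>2) * ((q 2)\<^sup>2 / (q 1 * q 3)) * 0"
    unfolding R_def[abs_def] by (intro tendsto_intros G_lim) auto
  then have "1 \<le> (0::real)"
    using R1 by (intro LIMSEQ_le_const[of R 0 1]) auto
  then show False by simp
qed

section \<open>Gram kernels\<close>

text \<open>Positive semidefiniteness in factored form, through real square-summable sequences:
  products and sums of kernels become explicit, and any orthonormal sequence realizes the kernel by
  vectors.\<close>

definition gram_kernel :: "('i \<Rightarrow> 'i \<Rightarrow> real) \<Rightarrow> bool" where
  "gram_kernel k \<longleftrightarrow> (\<exists>\<phi>::nat \<Rightarrow> 'i \<Rightarrow> real. \<forall>i j. ((\<lambda>s. \<phi> s i * \<phi> s j) has_sum k i j) UNIV)"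

lemma gram_kernel_pairI:
  fixes \<phi> :: "nat \<times> nat \<Rightarrow> 'i \<Rightarrow> real"
  assumes "\<And>i j. ((\<lambda>s. \<phi> s i * \<phi> s j) has_sum k i j) (UNIV \<times> UNIV)"
  shows "gram_kernel k"
  unfolding gram_kernel_def
proof (intro exI allI)
  have bij: "bij_betw prod_decode UNIV (UNIV :: (nat \<times> nat) set)" by (rule bij_prod_decode)
  show "((\<lambda>s. \<phi> (prod_decode s) i * \<phi> (prod_decode s) j) has_sum k i j) UNIV" for i j
    using has_sum_reindex_bij_betw[OF bij, of "\<lambda>s. \<phi> s i * \<phi> s j"] assms by simp
qed

text \<open>Schur's product theorem: the features of the product are the tensor products of the
  features, and absolute summability of both families justifies the double sum.\<close>

lemma gram_kernel_mult:
  assumes "gram_kernel k" "gram_kernel l"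
  shows "gram_kernel (\<lambda>i j. k i j * l i j)"
proof -
  obtain \<phi> \<psi> :: "nat \<Rightarrow> 'a \<Rightarrow> real" where
    phi: "\<And>i j. ((\<lambda>s. \<phi> s i * \<phi> s j) has_sum k i j) UNIV" and
    psi: "\<And>i j. ((\<lambda>s. \<psi> s i * \<psi> s j) has_sum l i j) UNIV"
    using assms unfolding gram_kernel_def by blast
  show ?thesis
  proof (rule gram_kernel_pairI[where \<phi> = "\<lambda>(s, t) i. \<phi> s i * \<psi> t i"])
    fix i j
    define f where "f s = \<phi> s i * \<phi> s j" for s
    define g where "g t = \<psi> t i * \<psi> t j" for t
    have f: "(f has_sum k i j) UNIV" unfolding f_def[abs_def] by (rule phi)
    have g: "(g has_sum l i j) UNIV" unfolding g_def[abs_def] by (rule psi)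
    have fs: "(\<lambda>s. \<bar>f s\<bar>) summable_on UNIV" and gs: "(\<lambda>s. \<bar>g s\<bar>) summable_on UNIV"
      using f g summable_on_iff_abs_summable_on_real[of f UNIV] summable_on_iff_abs_summable_on_real[of g UNIV]
      by (auto simp: summable_on_def)
    have "(\<lambda>(s, t). \<bar>f s\<bar> * \<bar>g t\<bar>) summable_on (UNIV \<times> UNIV)"
      by (rule summable_on_SigmaI[where g = "\<lambda>s. \<bar>f s\<bar> * (\<Sum>\<^sub>\<infinity>t. \<bar>g t\<bar>)"])
        (use fs gs in \<open>auto intro!: has_sum_cmult_right summable_on_cmult_left\<close>)
    then have "(\<lambda>st. norm ((\<lambda>(s, t). f s * g t) st)) summable_on (UNIV \<times> UNIV)"
      by (simp add: case_prod_unfold abs_mult)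
    then have "(\<lambda>(s, t). f s * g t) summable_on (UNIV \<times> UNIV)" by (rule abs_summable_summable)
    then have "((\<lambda>(s, t). f s * g t) has_sum k i j * l i j) (UNIV \<times> UNIV)"
      by (rule has_sum_SigmaI[where g = "\<lambda>s. f s * l i j", rotated 2])
        (auto intro!: has_sum_cmult_right has_sum_cmult_left f g)
    then show "((\<lambda>s. (case s of (s, t) \<Rightarrow> \<lambda>i. \<phi> s i * \<psi> t i) i * (case s of (s, t) \<Rightarrow> \<lambda>i. \<phi> s i * \<psi> t i) j)
        has_sum k i j * l i j) (UNIV \<times> UNIV)"
      by (simp add: f_def g_def case_prod_unfold mult_ac)
  qed
qed

text \<open>The feature sequences are concatenated. Off the diagonal, absolute summability of the
  double family is inherited from the two diagonal entries, whose terms are nonnegative, by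
  \<open>\<bar>x * y\<bar> \<le> x * x + y * y\<close>.\<close>

lemma gram_kernel_infsum:
  assumes k: "\<And>m::nat. gram_kernel (k m)" and sum: "\<And>i j. ((\<lambda>m. k m i j) has_sum l i j) UNIV"
  shows "gram_kernel l"
proof -
  have "\<exists>\<phi>::nat \<Rightarrow> 'a \<Rightarrow> real. \<forall>i j. ((\<lambda>s. \<phi> s i * \<phi> s j) has_sum k m i j) UNIV" for m
    using k[of m] unfolding gram_kernel_def .
  then obtain \<phi> :: "nat \<Rightarrow> nat \<Rightarrow> 'a \<Rightarrow> real" where
    phi: "\<And>m i j. ((\<lambda>s. \<phi> m s i * \<phi> m s j) has_sum k m i j) UNIV" by metis
  show ?thesis
  proof (rule gram_kernel_pairI[where \<phi> = "\<lambda>(m, s). \<phi> m s"])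
    fix i j
    have g_sum: "(\<lambda>(m, s). \<phi> m s i * \<phi> m s i + \<phi> m s j * \<phi> m s j) summable_on (UNIV \<times> UNIV)"
    proof (rule summable_on_SigmaI[where g = "\<lambda>m. k m i i + k m j j"])
      show "(\<lambda>m. k m i i + k m j j) summable_on UNIV"
        using has_sum_add[OF sum[of i i] sum[of j j]] by (auto simp: summable_on_def)
    qed (auto intro!: has_sum_add phi)
    have "(\<lambda>ms. norm ((\<lambda>(m, s). \<phi> m s i * \<phi> m s j) ms)) summable_on (UNIV \<times> UNIV)"
    proof (rule Infinite_Sum.abs_summable_on_comparison_test[where f = "\<lambda>(m, s). \<phi> m s i * \<phi> m s j"
          and g = "\<lambda>(m, s). \<phi> m s i * \<phi> m s i + \<phi> m s j * \<phi> m s j", rotated])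
      fix ms :: "nat \<times> nat"
      have "\<bar>x * y\<bar> \<le> x * x + y * y" for x y :: real
      proof -
        have "2 * (\<bar>x\<bar> * \<bar>y\<bar>) \<le> x * x + y * y"
          using sum_squares_bound[of "\<bar>x\<bar>" "\<bar>y\<bar>"] by (simp add: power2_eq_square)
        moreover have "0 \<le> \<bar>x\<bar> * \<bar>y\<bar>" by simp
        ultimately show ?thesis unfolding abs_mult by linarith
      qed
      then show "norm (case ms of (m, s) \<Rightarrow> \<phi> m s i * \<phi> m s j)
          \<le> norm (case ms of (m, s) \<Rightarrow> \<phi> m s i * \<phi> m s i + \<phi> m s j * \<phi> m s j)"
        by (auto simp: split_beta)
    qed (use g_sum in \<open>simp add: case_prod_unfold\<close>)
    then have "(\<lambda>(m, s). \<phi> m s i * \<phi> m s j) summable_on (UNIV \<times> UNIV)" by (rule abs_summable_summable)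
    then have "((\<lambda>(m, s). \<phi> m s i * \<phi> m s j) has_sum l i j) (UNIV \<times> UNIV)"
      by (rule has_sum_SigmaI[where g = "\<lambda>m. k m i j", rotated 2]) (simp_all add: phi sum)
    then show "((\<lambda>s. (case s of (m, s) \<Rightarrow> \<phi> m s) i * (case s of (m, s) \<Rightarrow> \<phi> m s) j) has_sum l i j) (UNIV \<times> UNIV)"
      by (simp add: case_prod_unfold)
  qed
qed

text \<open>Class indicators serve as features. Multiplying by this kernel cuts another one down to
  its diagonal blocks.\<close>

lemma gram_kernel_class:
  fixes cl :: "'i \<Rightarrow> nat"
  shows "gram_kernel (\<lambda>i j. if cl i = cl j then 1 else 0)"
  unfolding gram_kernel_def
proof (intro exI allI)
  fix i j
  show "((\<lambda>s. (if cl i = s then 1 else 0) * (if cl j = s then 1 else 0)) has_sum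
      (if cl i = cl j then 1 else 0 :: real)) UNIV"
    by (rule has_sum_finite_neutralI[of "{cl i}"]) auto
qed

lemma gram_kernel_const: "0 \<le> C \<Longrightarrow> gram_kernel (\<lambda>i j. C)"
  unfolding gram_kernel_def
  by (rule exI[of _ "\<lambda>s i. if s = 0 then sqrt C else 0"])
    (auto intro!: has_sum_finite_neutralI[of "{0}"] split: if_splits)

lemma gram_kernel_power: "gram_kernel k \<Longrightarrow> gram_kernel (\<lambda>i j. k i j ^ n)"
  by (induction n) (simp_all add: gram_kernel_const gram_kernel_mult)

text \<open>With \<open>z = (p - 1) / (p + 1)\<close> and \<open>w = (q - 1) / (q + 1)\<close> one has
  \<open>1 / (p + q) = (1 - z) (1 - w) / (2 (1 - z w))\<close>, which is a geometric series.\<close>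

lemma gram_kernel_Cauchy:
  assumes pos: "\<And>i. 0 < p i"
  shows "gram_kernel (\<lambda>i j. 1 / (p i + p j))"
proof -
  define z where "z i = (p i - 1) / (p i + 1)" for i
  have z: "\<bar>z i\<bar> < 1" for i using pos[of i] by (simp add: z_def abs_less_iff field_simps)
  have "((\<lambda>n. ((1 - z i) * z i ^ n / sqrt 2) * ((1 - z j) * z j ^ n / sqrt 2)) has_sum 1 / (p i + p j)) UNIV"
    for i j
  proof -
    have zz: "\<bar>z i * z j\<bar> < 1" using abs_mult_less[OF z z, of i j] by (simp add: abs_mult)
    have geo: "((\<lambda>n. (z i * z j) ^ n) has_sum 1 / (1 - z i * z j)) UNIV"
      using zz geometric_sums[of "z i * z j"] 
      by (intro norm_summable_imp_has_sum) (auto simp: power_abs summable_geometric)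
    have z1: "1 - z i = 2 / (p i + 1)" for i using pos[of i] by (simp add: z_def field_simps)
    have z2: "1 - z i * z j = 2 * (p i + p j) / ((p i + 1) * (p j + 1))"
    proof -
      define D where "D = (p i + 1) * (p j + 1)"
      have "D \<noteq> 0" using pos[of i] pos[of j] by (simp add: D_def)
      have "z i * z j = (p i - 1) * (p j - 1) / D" by (simp add: z_def D_def)
      then have "1 - z i * z j = (D - (p i - 1) * (p j - 1)) / D" using \<open>D \<noteq> 0\<close> by (simp add: diff_divide_distrib)
      also have "D - (p i - 1) * (p j - 1) = 2 * (p i + p j)" by (simp add: D_def algebra_simps)
      finally show ?thesis by (simp add: D_def)
    qed
    have "(1 - z i) * (1 - z j) / 2 * (1 / (1 - z i * z j)) = 1 / (p i + p j)"
    proof -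
      have "2 / A * (2 / B) / 2 * (1 / (2 * S / (A * B))) = 1 / S" if "0 < A" "0 < B" "0 < S" for A B S :: real
        using that by (simp add: field_simps)
      from this[of "p i + 1" "p j + 1" "p i + p j"] show ?thesis
        unfolding z1 z2 using pos[of i] pos[of j] by (simp only: add_pos_pos zero_less_one)
    qed
    with has_sum_cmult_right[OF geo, of "(1 - z i) * (1 - z j) / 2"]
    have "((\<lambda>n. (1 - z i) * (1 - z j) / 2 * (z i * z j) ^ n) has_sum 1 / (p i + p j)) UNIV" by simp
    moreover have "(1 - z i) * (1 - z j) / 2 * (z i * z j) ^ n
        = ((1 - z i) * z i ^ n / sqrt 2) * ((1 - z j) * z j ^ n / sqrt 2)" for n
      by (simp add: power_mult_distrib)
    ultimately show ?thesis by (simp only:)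
  qed
  then show ?thesis unfolding gram_kernel_def
    by (intro exI[of _ "\<lambda>n i. (1 - z i) * z i ^ n / sqrt 2"]) blast
qed

lemma gram_kernel_inverse_bilinear:
  assumes x: "\<And>i. 0 < x i" and y: "\<And>i. 0 < y i" and "0 \<le> d"
    and d: "\<And>i j. d < (x i + x j) * (y i + y j)"
  shows "gram_kernel (\<lambda>i j. 1 / ((x i + x j) * (y i + y j) - d))"
proof (rule gram_kernel_infsum)
  fix m
  show "gram_kernel (\<lambda>i j. d ^ m * (1 / (x i + x j) * (1 / (y i + y j))) ^ Suc m)"
    by (intro gram_kernel_mult gram_kernel_power gram_kernel_Cauchy gram_kernel_const x y) (simp add: \<open>0 \<le> d\<close>)
next
  fix i j
  define X where "X = (x i + x j) * (y i + y j)"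
  have X: "d < X" "0 < X" using d[of i j] \<open>0 \<le> d\<close> by (simp_all add: X_def)
  have "((\<lambda>m. (d / X) ^ m) has_sum 1 / (1 - d / X)) UNIV"
    using X \<open>0 \<le> d\<close> geometric_sums[of "d / X"]
    by (intro norm_summable_imp_has_sum) (auto simp: power_abs summable_geometric)
  from has_sum_cmult_right[OF this, of "1 / X"]
  have "((\<lambda>m. 1 / X * (d / X) ^ m) has_sum 1 / (X - d)) UNIV" using X by (simp add: field_simps)
  moreover have "1 / X * (d / X) ^ m = d ^ m * (1 / (x i + x j) * (1 / (y i + y j))) ^ Suc m" for m
    by (simp add: X_def power_divide)
  ultimately show "((\<lambda>m. d ^ m * (1 / (x i + x j) * (1 / (y i + y j))) ^ Suc m) has_sum
      1 / ((x i + x j) * (y i + y j) - d)) UNIV"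
    by (simp only: X_def[symmetric])
qed

text \<open>Pairs \<open>(\<alpha>, \<beta>)\<close> index the vectors \<open>N\<^sup>*\<^sup>\<beta> N\<^sup>\<alpha> x\<close> of a normal pair; their Gram matrix
  is supported on the classes of \<open>\<alpha> - \<beta>\<close>, where it depends on the sum of the midpoints
  \<open>(\<alpha> + \<beta>) / 2\<close>.\<close>

definition normal_kernel :: "(nat \<times> nat \<Rightarrow> real) \<Rightarrow> (nat \<times> nat) \<times> (nat \<times> nat) \<Rightarrow> (nat \<times> nat) \<times> (nat \<times> nat) \<Rightarrow> real"
  where "normal_kernel \<delta> i j = (if fst i + snd j = fst j + snd i then \<delta> (fst i + snd j) else 0)"

text \<open>Without the support condition the kernel extends to all pairs as \<open>F\<close>,
  evaluated at sums of midpoints; the condition is restored by a Schur product with a class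
  kernel.\<close>

lemma gram_kernel_normal_kernel:
  fixes a b c :: real
  assumes nonneg: "0 \<le> a" "0 \<le> b" "0 \<le> c" and "c = 0 \<or> c \<le> a * b"
  shows "gram_kernel (normal_kernel (\<lambda>(k, l). 1 / (1 + a * real k + b * real l + c * real k * real l)))"
proof -
  define u v :: "(nat \<times> nat) \<times> (nat \<times> nat) \<Rightarrow> real"
    where "u i = (real (fst (fst i)) + real (fst (snd i))) / 2"
      and "v i = (real (snd (fst i)) + real (snd (snd i))) / 2" for i
  have uv: "0 \<le> u i" "0 \<le> v i" for i by (simp_all add: u_def v_def)
  define F where "F i j = 1 / (1 + a * (u i + u j) + b * (v i + v j) + c * (u i + u j) * (v i + v j))" for i j
  have F: "gram_kernel F"
  proof (cases "c = 0")
    case True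
    have "F = (\<lambda>i j. 1 / ((1 / 2 + a * u i + b * v i) + (1 / 2 + a * u j + b * v j)))"
      by (intro ext) (simp add: F_def True algebra_simps)
    then show ?thesis
      using gram_kernel_Cauchy[of "\<lambda>i. 1 / 2 + a * u i + b * v i"] nonneg uv by (simp add: add_pos_nonneg)
  next
    case False
    then have c: "0 < c" "c \<le> a * b" using assms by auto
    then have ab: "0 < a" "0 < b" using nonneg by (smt (verit) mult_eq_0_iff)+
    \<comment> \<open>Completing the product: with \<open>U\<close>, \<open>V\<close> the sums of
      midpoints, \<open>(c U + b) (V + a / c)\<close> exceeds the denominator by
      \<open>a b / c - 1\<close>, which is nonnegative because \<open>c \<le> a * b\<close>. The
      shifts \<open>b\<close> and \<open>a / c\<close> are split evenly between \<open>i\<close> and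
      \<open>j\<close>.\<close>
    define x y where "x i = c * u i + b / 2" and "y i = v i + a / (2 * c)" for i
    define d where "d = a * b / c - 1"
    have eq: "(x i + x j) * (y i + y j) - d
        = 1 + a * (u i + u j) + b * (v i + v j) + c * (u i + u j) * (v i + v j)" for i j
      using c(1) by (simp add: x_def y_def d_def field_simps)
    have "gram_kernel (\<lambda>i j. 1 / ((x i + x j) * (y i + y j) - d))"
    proof (rule gram_kernel_inverse_bilinear)
      show "0 < x i" "0 < y i" for i using c(1) ab uv by (simp_all add: x_def y_def add_nonneg_pos)
      show "0 \<le> d" using c by (simp add: d_def)
      have "0 < (x i + x j) * (y i + y j) - d" for i j
        unfolding eq using nonneg uv by (intro add_pos_nonneg) auto
      then show "d < (x i + x j) * (y i + y j)" for i j by (simp add: algebra_simps)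
    qed
    then show ?thesis unfolding eq F_def[abs_def] .
  qed
  \<comment> \<open>The class is the integer vector \<open>\<alpha> - \<beta>\<close>, coded as a
    natural number since class labels are natural numbers.\<close>
  define cl :: "(nat \<times> nat) \<times> (nat \<times> nat) \<Rightarrow> nat" where
    "cl i = to_nat (int (fst (fst i)) - int (fst (snd i)), int (snd (fst i)) - int (snd (snd i)))" for i
  have "normal_kernel (\<lambda>(k, l). 1 / (1 + a * real k + b * real l + c * real k * real l)) i j
      = (if cl i = cl j then 1 else 0) * F i j" for i j
  proof -
    obtain a1 a2 b1 b2 c1 c2 d1 d2 where ij: "i = ((a1, a2), (b1, b2))" "j = ((c1, c2), (d1, d2))"
      by (metis surj_pair)
    have cl: "cl i = cl j \<longleftrightarrow> fst i + snd j = fst j + snd i"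
      by (auto simp: cl_def ij)
    show ?thesis
    proof (cases "cl i = cl j")
      case True
      then have "a1 + d1 = c1 + b1" "a2 + d2 = c2 + b2" using cl ij by auto
      then have uv': "u i + u j = real (a1 + d1)" "v i + v j = real (a2 + d2)"
        unfolding u_def v_def ij by (simp_all flip: of_nat_add) (simp_all add: field_simps)
      have "normal_kernel (\<lambda>(k, l). 1 / (1 + a * real k + b * real l + c * real k * real l)) i j
          = 1 / (1 + a * real (a1 + d1) + b * real (a2 + d2) + c * real (a1 + d1) * real (a2 + d2))"
        unfolding normal_kernel_def if_P[OF cl[THEN iffD1, OF True]] by (simp add: ij)
      then show ?thesis using True by (simp add: F_def uv')
    next
      case False
      then show ?thesis using cl by (simp add: normal_kernel_def)
    qed
  qed
  then have "normal_kernel (\<lambda>(k, l). 1 / (1 + a * real k + b * real l + c * real k * real l))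
      = (\<lambda>i j. (if cl i = cl j then 1 else 0) * F i j)" by blast
  then show ?thesis using gram_kernel_mult[OF gram_kernel_class F] by simp
qed

instance chilbert_space \<subseteq> banach ..

lemma norm_sum_orthonormal:
  assumes "\<And>i j. cinner (u i) (u j) = (if i = j then 1 else 0)" "finite A"
  shows "(norm (\<Sum>i\<in>A. r i *\<^sub>R u i))\<^sup>2 = (\<Sum>i\<in>A. (r i)\<^sup>2 :: real)"
proof -
  have "cinner (\<Sum>i\<in>A. r i *\<^sub>R u i) (\<Sum>i\<in>A. r i *\<^sub>R u i) = of_real (\<Sum>i\<in>A. (r i)\<^sup>2)"
    using \<open>finite A\<close>
    by (simp add: cinner_sum_left cinner_sum_right cinner_scaleR_left cinner_scaleR_right assms(1)
        if_distrib[of "(*) _"] sum.delta sum.delta' power2_eq_square cong: if_cong)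
  then show ?thesis by (simp add: norm_sq_eq_Re_cinner)
qed

text \<open>The vectors are found in the space of the given orthonormal sequence; this is why the
  normal extension needs no larger carrier type than the shift.\<close>

lemma gram_kernel_vectors:
  fixes u :: "nat \<Rightarrow> 'a::chilbert_space"
  assumes k: "gram_kernel k" and u: "\<And>i j. cinner (u i) (u j) = (if i = j then 1 else 0)"
  obtains g where "\<And>i j. cinner (g i) (g j :: 'a) = of_real (k i j)"
proof -
  obtain \<phi> :: "nat \<Rightarrow> 'b \<Rightarrow> real" where
    "\<And>i j. ((\<lambda>s. \<phi> s i * \<phi> s j) has_sum k i j) UNIV" using k unfolding gram_kernel_def by blast
  then have phi: "(\<lambda>s. \<phi> s i * \<phi> s j) sums k i j" for i j by (rule has_sum_imp_sums)
  have "summable (\<lambda>s. \<phi> s i *\<^sub>R u s)" for i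
  proof (subst summable_Cauchy, intro allI impI)
    fix e :: real assume "0 < e"
    have "summable (\<lambda>s. (\<phi> s i)\<^sup>2)" using phi[of i i] by (simp add: sums_iff power2_eq_square)
    then obtain M where M: "\<And>m n. m \<ge> M \<Longrightarrow> norm (\<Sum>s=m..<n. (\<phi> s i)\<^sup>2) < e\<^sup>2"
      using \<open>0 < e\<close> unfolding summable_Cauchy by (meson zero_less_power)
    have "norm (\<Sum>s=m..<n. \<phi> s i *\<^sub>R u s) < e" if "m \<ge> M" for m n
    proof (rule power2_less_imp_less)
      show "(norm (\<Sum>s=m..<n. \<phi> s i *\<^sub>R u s))\<^sup>2 < e\<^sup>2"
        using M[OF that, of n] norm_sum_orthonormal[OF u, of "{m..<n}" "\<lambda>s. \<phi> s i"] by simp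
    qed (use \<open>0 < e\<close> in simp)
    then show "\<exists>M. \<forall>m\<ge>M. \<forall>n. norm (\<Sum>s=m..<n. \<phi> s i *\<^sub>R u s) < e" by blast
  qed
  then have g: "(\<lambda>n. \<Sum>s<n. \<phi> s i *\<^sub>R u s) \<longlonglongrightarrow> (\<Sum>s. \<phi> s i *\<^sub>R u s)" for i
    by (simp add: summable_LIMSEQ)
  have gram: "cinner (\<Sum>s. \<phi> s i *\<^sub>R u s) (\<Sum>s. \<phi> s j *\<^sub>R u s) = of_real (k i j)" for i j
  proof (rule LIMSEQ_unique)
    show "(\<lambda>n. cinner (\<Sum>s<n. \<phi> s i *\<^sub>R u s) (\<Sum>s<n. \<phi> s j *\<^sub>R u s))
        \<longlonglongrightarrow> cinner (\<Sum>s. \<phi> s i *\<^sub>R u s) (\<Sum>s. \<phi> s j *\<^sub>R u s)"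
      by (rule tendsto_cinner[OF g g])
    have "cinner (\<Sum>s<n. \<phi> s i *\<^sub>R u s) (\<Sum>s<n. \<phi> s j *\<^sub>R u s) = of_real (\<Sum>s<n. \<phi> s i * \<phi> s j)" for n
      by (simp add: cinner_sum_left cinner_sum_right cinner_scaleR_left cinner_scaleR_right u
          if_distrib[of "(*) _"] sum.delta sum.delta' mult.commute cong: if_cong)
    moreover have "(\<lambda>n. of_real (\<Sum>s<n. \<phi> s i * \<phi> s j)) \<longlonglongrightarrow> complex_of_real (k i j)"
      using phi[of i j] unfolding sums_def by (rule tendsto_of_real)
    ultimately show "(\<lambda>n. cinner (\<Sum>s<n. \<phi> s i *\<^sub>R u s) (\<Sum>s<n. \<phi> s j *\<^sub>R u s)) \<longlonglongrightarrow> of_real (k i j)"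
      by simp
  qed
  show thesis by (rule that[OF gram])
qed

section \<open>Normal extensions from Gram matrices\<close>

text \<open>The formal operator taking \<open>g i\<close> to \<open>g (\<pi> i)\<close> is
  symmetric, so the norms of the iterates \<open>z n\<close> are log-convex. Were the first step to
  increase the norm, all later ratios would be at least \<open>t > 1\<close>, and geometric growth
  would contradict the bound that \<open>B\<close> gives uniformly in \<open>n\<close>.\<close>

lemma symmetric_shift_contraction:
  fixes g :: "'i \<Rightarrow> 'a::chilbert_space"
  assumes symm: "\<And>i j. cinner (g (\<pi> i)) (g j) = cinner (g i) (g (\<pi> j))"
    and bdd: "\<And>i. norm (g i) \<le> B" and F: "finite F"
  shows "norm (\<Sum>i\<in>F. c i *\<^sub>C g (\<pi> i)) \<le> norm (\<Sum>i\<in>F. c i *\<^sub>C g i)"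
proof -
  define z where "z n = (\<Sum>i\<in>F. c i *\<^sub>C g ((\<pi> ^^ n) i))" for n
  have step: "(norm (z (Suc n)))\<^sup>2 \<le> norm (z (Suc (Suc n))) * norm (z n)" for n
  proof -
    have "cinner (z (Suc n)) (z (Suc n)) = cinner (z (Suc (Suc n))) (z n)"
      by (simp add: z_def cinner_sum_left cinner_sum_right cinner_scaleC_left cinner_scaleC_right symm)
    then show ?thesis
      using Re_cinner_le[of "z (Suc (Suc n))" "z n"] by (simp add: norm_sq_eq_Re_cinner)
  qed
  have "norm (z n) \<le> (\<Sum>i\<in>F. cmod (c i) * B)" for n
    unfolding z_def by (rule sum_norm_le) (auto simp: norm_scaleC intro!: mult_left_mono bdd)
  then obtain C where C: "\<And>n. norm (z n) \<le> C" by blast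
  have "norm (z 1) \<le> norm (z 0)"
  proof (rule ccontr)
    assume "\<not> ?thesis"
    then have less: "norm (z 0) < norm (z 1)" by simp
    have pos: "norm (z 0) > 0"
    proof (rule ccontr)
      assume "\<not> 0 < norm (z 0)"
      then show False using step[of 0] less by simp
    qed
    define t where "t = norm (z 1) / norm (z 0)"
    have t: "t > 1" using less pos by (simp add: t_def)
    have grow: "norm (z n) > 0 \<and> norm (z (Suc n)) \<ge> t * norm (z n)" for n
    proof (induction n)
      case 0
      then show ?case using pos by (simp add: t_def)
    next
      case (Suc n)
      then have p: "norm (z (Suc n)) > 0" using t by (smt (verit) mult_pos_pos)
      have "norm (z (Suc n)) * (t * norm (z n)) \<le> norm (z (Suc n)) * norm (z (Suc n))"
        using Suc p by (intro mult_left_mono) auto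
      also have "\<dots> \<le> norm (z (Suc (Suc n))) * norm (z n)" using step[of n] by (simp add: power2_eq_square)
      finally have "t * norm (z (Suc n)) * norm (z n) \<le> norm (z (Suc (Suc n))) * norm (z n)"
        by (simp add: ac_simps)
      then show ?case using Suc p by (simp add: mult_le_cancel_right_pos)
    qed
    have "norm (z n) \<ge> t ^ n * norm (z 0)" for n
    proof (induction n)
      case (Suc n)
      have "t ^ Suc n * norm (z 0) \<le> t * norm (z n)" using Suc t by simp
      then show ?case using grow[of n] by linarith
    qed simp
    moreover obtain n where "t ^ n > C / norm (z 0)" using real_arch_pow[OF t] by blast
    ultimately show False using C[of n] pos by (smt (verit) divide_less_eq)
  qed
  then show ?thesis by (simp add: z_def)
qed

text \<open>The shift along \<open>\<sigma>\<close> need not be symmetric, but the one along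
  \<open>\<tau> \<circ> \<sigma>\<close>, its formal modulus squared, is; the contraction property
  of the latter bounds the former by Cauchy-Schwarz.\<close>

lemma normal_op_of_shift:
  fixes g :: "'i \<Rightarrow> 'a::chilbert_space"
  assumes adjoint: "\<And>i j. cinner (g (\<sigma> i)) (g j) = cinner (g i) (g (\<tau> j))"
    and comm: "\<And>i. \<sigma> (\<tau> i) = \<tau> (\<sigma> i)" and bdd: "\<And>i. norm (g i) \<le> B"
  obtains N where "normal_op N" "\<And>i. N (g i) = g (\<sigma> i)"
    "\<And>x. (\<And>i. cinner (g i) x = 0) \<Longrightarrow> N x = 0"
proof -
  have adjoint': "cinner (g (\<tau> i)) (g j) = cinner (g i) (g (\<sigma> j))" for i j
    using adjoint[of j i] cinner_commute[of "g (\<tau> i)" "g j"] cinner_commute[of "g i" "g (\<sigma> j)"] by simp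
  have bound: "norm (\<Sum>i\<in>F. c i *\<^sub>C g (\<sigma> i)) \<le> 1 * norm (\<Sum>i\<in>F. c i *\<^sub>C g i)" if F: "finite F" for F c
  proof (rule power2_le_imp_le)
    let ?v = "\<Sum>i\<in>F. c i *\<^sub>C g i" and ?w = "\<Sum>i\<in>F. c i *\<^sub>C g (\<tau> (\<sigma> i))"
    have "cinner (\<Sum>i\<in>F. c i *\<^sub>C g (\<sigma> i)) (\<Sum>i\<in>F. c i *\<^sub>C g (\<sigma> i)) = cinner ?w ?v"
      by (simp add: cinner_sum_left cinner_sum_right cinner_scaleC_left cinner_scaleC_right adjoint')
    then have "(norm (\<Sum>i\<in>F. c i *\<^sub>C g (\<sigma> i)))\<^sup>2 \<le> norm ?w * norm ?v"
      using Re_cinner_le[of ?w ?v] by (simp add: norm_sq_eq_Re_cinner)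
    also have "\<dots> \<le> norm ?v * norm ?v"
    proof (intro mult_right_mono norm_ge_zero)
      show "norm ?w \<le> norm ?v"
        by (rule symmetric_shift_contraction[of g "\<lambda>i. \<tau> (\<sigma> i)" B, OF _ bdd F]) (simp add: adjoint adjoint' comm)
    qed
    finally show "(norm (\<Sum>i\<in>F. c i *\<^sub>C g (\<sigma> i)))\<^sup>2 \<le> (1 * norm ?v)\<^sup>2" by (simp add: power2_eq_square)
  qed simp
  obtain N where N: "bounded_clinear N" and Ng: "\<And>i. N (g i) = g (\<sigma> i)"
    and N0: "\<And>x. (\<And>i. cinner (g i) x = 0) \<Longrightarrow> N x = 0"
    using bounded_clinear_extension[of "\<lambda>i. g (\<sigma> i)" 1 g, OF bound] by metis
  have adj_g: "adj N (g j) = g (\<tau> j)" for j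
  proof -
    \<comment> \<open>\<open>v\<close> is orthogonal to every \<open>g i\<close>, so
      \<open>N v = 0\<close>; hence \<open>v\<close> is also orthogonal to
      \<open>adj N (g j)\<close> and therefore to itself.\<close>
    define v where "v = adj N (g j) - g (\<tau> j)"
    have "cinner (g i) v = 0" for i
      by (simp add: v_def cinner_diff_right cinner_adj_right[OF N] Ng adjoint)
    moreover from this have "cinner v (g (\<tau> j)) = 0" using cinner_commute[of v "g (\<tau> j)"] by simp
    ultimately have "cinner v v = 0"
      using N0[of v]
      by (simp add: v_def cinner_diff_right cinner_adj_right[OF N])
    then show ?thesis by (simp add: cinner_same v_def)
  qed
  have adj_0: "adj N x = 0" if x: "\<And>i. cinner (g i) x = 0" for x
  proof -
    have "cinner (g i) (adj N x) = 0" for i by (simp add: cinner_adj_right[OF N] Ng x)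
    then have "N (adj N x) = 0" by (rule N0)
    then have "cinner (adj N x) (adj N x) = 0" by (simp add: cinner_adj_right[OF N])
    then show ?thesis by (simp add: cinner_same)
  qed
  have "adj N \<circ> N = N \<circ> adj N"
  proof (rule clinear_eq_on_generators[where g = g])
    show "(adj N \<circ> N) x = (N \<circ> adj N) x" if "\<And>i. cinner (g i) x = 0" for x
      using N0[OF that] adj_0[OF that] bounded_clinear_zero[OF N] bounded_clinear_zero[OF bounded_clinear_adj[OF N]]
      by simp
  qed (auto intro: bounded_clinear_comp N bounded_clinear_adj simp: Ng adj_g comm)
  then have "normal_op N" using N by (simp add: normal_op_def)
  then show thesis by (rule that[OF _ Ng N0])
qed

lemma norm_sum_eq_of_gram_eq:
  fixes g :: "'i \<Rightarrow> 'a::complex_inner" and h :: "'i \<Rightarrow> 'b::complex_inner"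
  assumes "\<And>i j. cinner (g i) (g j) = cinner (h i) (h j)"
  shows "norm (\<Sum>i\<in>F. c i *\<^sub>C g i) = norm (\<Sum>i\<in>F. c i *\<^sub>C h i)"
proof -
  have "cinner (\<Sum>i\<in>F. c i *\<^sub>C g i) (\<Sum>i\<in>F. c i *\<^sub>C g i)
      = cinner (\<Sum>i\<in>F. c i *\<^sub>C h i) (\<Sum>i\<in>F. c i *\<^sub>C h i)"
    by (simp add: cinner_sum_left cinner_sum_right cinner_scaleC_left cinner_scaleC_right assms)
  then have "(norm (\<Sum>i\<in>F. c i *\<^sub>C g i))\<^sup>2 = (norm (\<Sum>i\<in>F. c i *\<^sub>C h i))\<^sup>2"
    by (simp add: norm_sq_eq_Re_cinner)
  then show ?thesis by simp
qed

lemma linear_isometry_of_gram_eq: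
  fixes f g :: "'i \<Rightarrow> 'a::chilbert_space"
  assumes gram: "\<And>i j. cinner (g i) (g j) = cinner (f i) (f j)"
    and total: "\<And>x. (\<And>i. cinner (f i) x = 0) \<Longrightarrow> x = 0"
  obtains V where "linear_isometry V" "\<And>i. V (f i) = g i"
proof -
  have "norm (\<Sum>i\<in>F. c i *\<^sub>C g i) \<le> 1 * norm (\<Sum>i\<in>F. c i *\<^sub>C f i)" for F c
    using norm_sum_eq_of_gram_eq[of g f, OF gram] by simp
  then obtain V where V: "bounded_clinear V" and Vf: "\<And>i. V (f i) = g i"
    using bounded_clinear_extension[of g 1 f] by metis
  \<comment> \<open>The Gram identity only tests pairs of generators; it is carried to all vectors
    in the form \<open>adj V \<circ> V = id\<close>, which can be checked on a total family.\<close>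
  have adj_g: "adj V (V (f j)) = f j" for j
  proof -
    have "adj V (V (f j)) - f j = 0"
      by (rule total) (simp add: cinner_diff_right cinner_adj_right[OF V] Vf gram)
    then show ?thesis by simp
  qed
  have "adj V \<circ> V = id"
  proof (rule clinear_eq_on_total[where g = f])
    show "bounded_clinear id" using bounded_clinear_ident by (simp add: id_def)
  qed (simp_all add: bounded_clinear_comp V bounded_clinear_adj adj_g total)
  then have "adj V (V y) = y" for y by (metis comp_apply id_apply)
  then have "cinner (V x) (V y) = cinner x y" for x y
    using cinner_adj_right[OF V, of x "V y"] by simp
  then have "linear_isometry V" using V by (simp add: linear_isometry_def)
  then show thesis using Vf by (rule that)
qed

theorem jointly_subnormal_of_gram_kernel:
  fixes f :: "nat \<times> nat \<Rightarrow> 'a::chilbert_space" and u :: "nat \<Rightarrow> 'a"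
  assumes u: "\<And>i j. cinner (u i) (u j) = (if i = j then 1 else 0)"
    and total: "\<And>x. (\<And>\<alpha>. cinner (f \<alpha>) x = 0) \<Longrightarrow> x = 0"
    and f: "\<And>\<alpha> \<beta>. cinner (f \<alpha>) (f \<beta>) = of_real (if \<alpha> = \<beta> then \<delta> \<alpha> else 0)"
    and T: "commuting_pair T1 T2" "\<And>\<alpha>. T1 (f \<alpha>) = f (\<alpha> + (1, 0))" "\<And>\<alpha>. T2 (f \<alpha>) = f (\<alpha> + (0, 1))"
    and kernel: "gram_kernel (normal_kernel \<delta>)" and le: "\<And>\<alpha>. \<delta> \<alpha> \<le> 1"
  shows "jointly_subnormal_in TYPE('a) T1 T2"
proof -
  obtain g where g: "\<And>i j. cinner (g i) (g j :: 'a) = of_real (normal_kernel \<delta> i j)"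
    using gram_kernel_vectors[OF kernel u] by metis
  have g_le: "norm (g i) \<le> 1" for i
  proof (rule power2_le_imp_le)
    show "(norm (g i))\<^sup>2 \<le> 1\<^sup>2"
      unfolding norm_sq_eq_Re_cinner g using le by (simp add: normal_kernel_def)
  qed simp
  \<comment> \<open>\<open>g (\<alpha>, \<beta>)\<close> stands for the cyclic vector with the
    normal pair applied \<open>\<alpha>\<close> times and its adjoints \<open>\<beta>\<close> times:
    \<open>\<sigma>\<close> raises the first exponent, \<open>\<tau>\<close> the second. The
    embedded copy of \<open>f \<alpha>\<close> is \<open>g (\<alpha>, 0)\<close>.\<close>
  define \<sigma> \<tau> :: "nat \<times> nat \<Rightarrow> (nat \<times> nat) \<times> (nat \<times> nat) \<Rightarrow> (nat \<times> nat) \<times> (nat \<times> nat)"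
    where "\<sigma> \<epsilon> i = (fst i + \<epsilon>, snd i)" and "\<tau> \<epsilon> i = (fst i, snd i + \<epsilon>)" for \<epsilon> i
  have "\<exists>N. normal_op N \<and> (\<forall>i. N (g i) = g (\<sigma> \<epsilon> i)) \<and> (\<forall>x. (\<forall>i. cinner (g i) x = 0) \<longrightarrow> N x = 0)" for \<epsilon>
  proof -
    have "cinner (g (\<sigma> \<epsilon> i)) (g j) = cinner (g i) (g (\<tau> \<epsilon> j))" for i j
      unfolding g normal_kernel_def \<sigma>_def \<tau>_def by (simp add: add_ac)
    then obtain N where "normal_op N" "\<And>i. N (g i) = g (\<sigma> \<epsilon> i)"
      "\<And>x. (\<And>i. cinner (g i) x = 0) \<Longrightarrow> N x = 0"
      by (rule normal_op_of_shift[of g "\<sigma> \<epsilon>" "\<tau> \<epsilon>" 1]) (simp_all add: g_le \<sigma>_def \<tau>_def)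
    then show ?thesis by blast
  qed
  then obtain N where N: "\<And>\<epsilon>. normal_op (N \<epsilon>)" "\<And>\<epsilon> i. N \<epsilon> (g i) = g (\<sigma> \<epsilon> i)"
    "\<And>\<epsilon> x. (\<And>i. cinner (g i) x = 0) \<Longrightarrow> N \<epsilon> x = 0" by metis
  have cl: "bounded_clinear (N \<epsilon>)" for \<epsilon> using N(1) by (simp add: normal_op_def)
  have N_comm: "N \<epsilon> \<circ> N \<epsilon>' = N \<epsilon>' \<circ> N \<epsilon>" for \<epsilon> \<epsilon>'
  proof (rule clinear_eq_on_generators[where g = g])
    show "(N \<epsilon> \<circ> N \<epsilon>') x = (N \<epsilon>' \<circ> N \<epsilon>) x" if "\<And>i. cinner (g i) x = 0" for x
      using N(3)[OF that] bounded_clinear_zero[OF cl] by simp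
  qed (simp_all add: bounded_clinear_comp cl N(2) \<sigma>_def add_ac)
  have "cinner (g (\<alpha>, 0)) (g (\<beta>, 0)) = cinner (f \<alpha>) (f \<beta>)" for \<alpha> \<beta>
    unfolding g f normal_kernel_def by simp
  then obtain V where V: "linear_isometry V" "\<And>\<alpha>. V (f \<alpha>) = g (\<alpha>, 0)"
    using linear_isometry_of_gram_eq[of "\<lambda>\<alpha>. g (\<alpha>, 0)" f] total by metis
  have clV: "bounded_clinear V" using V(1) by (simp add: linear_isometry_def)
  have ext: "N \<epsilon> \<circ> V = V \<circ> S" if S: "bounded_clinear S" "\<And>\<alpha>. S (f \<alpha>) = f (\<alpha> + \<epsilon>)" for \<epsilon> S
    by (rule clinear_eq_on_total[where g = f])
      (simp_all add: bounded_clinear_comp cl clV S N(2) V(2) \<sigma>_def total)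
  have "bounded_clinear T1" "bounded_clinear T2" using T(1) by (simp_all add: commuting_pair_def)
  then have "N (1, 0) \<circ> V = V \<circ> T1" "N (0, 1) \<circ> V = V \<circ> T2" using T by (auto intro: ext)
  then show ?thesis
    unfolding jointly_subnormal_in_def using T(1) V(1) N(1) N_comm by blast
qed

section \<open>Weighted 2-shifts\<close>

lemma m_isometry_2_norm:
  assumes "m_isometry 2 T"
  shows "(norm (x::'a::chilbert_space))\<^sup>2 - 2 * (norm (T x))\<^sup>2 + (norm (T (T x)))\<^sup>2 = 0"
proof -
  have T: "bounded_clinear T"
    and "(\<Sum>i\<le>2. ((-1) ^ i * real (2 choose i)) *\<^sub>R (adj T ^^ i) ((T ^^ i) x)) = 0"
    using assms by (simp_all add: m_isometry_def)
  then have "x - 2 *\<^sub>R adj T (T x) + adj T (adj T (T (T x))) = 0"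
    by (simp add: numeral_2_eq_2)
  then have "Re (cinner (x - 2 *\<^sub>R adj T (T x) + adj T (adj T (T (T x)))) x) = 0" by simp
  then show ?thesis
    by (simp add: cinner_add_left cinner_diff_left cinner_scaleR_left cinner_adj_left[OF T] norm_sq_eq_Re_cinner)
qed

lemma second_difference_zero_imp_affine:
  fixes g :: "nat \<Rightarrow> real"
  assumes "\<And>n. g n - 2 * g (Suc n) + g (Suc (Suc n)) = 0"
  shows "g n = g 0 + real n * (g 1 - g 0)"
proof -
  have "g n = g 0 + real n * (g 1 - g 0) \<and> g (Suc n) = g 0 + real (Suc n) * (g 1 - g 0)"
  proof (induction n)
    case (Suc n)
    then show ?case using assms[of n] by (simp add: algebra_simps)
  qed simp
  then show ?thesis ..
qed

lemma affine_nonneg_imp_slope_nonneg: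
  fixes p q :: real
  assumes "\<And>n. 0 \<le> p + q * real n"
  shows "0 \<le> q"
proof (rule ccontr)
  assume "\<not> 0 \<le> q"
  moreover obtain n :: nat where "p / - q < real n" using reals_Archimedean2 by blast
  ultimately show False using assms[of n] by (simp add: field_simps)
qed

lemma orthonormal_basis_total:
  assumes "orthonormal_basis e" "\<And>i. cinner (e i) x = 0"
  shows "x = 0"
proof -
  \<comment> \<open>The functional \<open>\<lambda>z. cinner z x\<close> is turned into a rank-one
    operator so that uniqueness on a dense span, stated for operators, applies to it.\<close>
  have cl: "bounded_clinear (\<lambda>z. cinner z x *\<^sub>C x)"
    by (rule bounded_clinearI[where C = "norm x * norm x"])
      (auto simp: cinner_add_left cinner_scaleC_left scaleC_add_left scaleC_scaleC norm_scaleC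
        mult.commute[of "norm x * norm x"] mult.assoc[symmetric] intro!: mult_right_mono cmod_cinner_le)
  have "cinner x x *\<^sub>C x = 0"
    by (rule clinear_eq_on_cspan[OF cl bounded_clinear_const_zero, of e x])
      (use assms in \<open>simp_all add: orthonormal_basis_def\<close>)
  then have "norm (cinner x x *\<^sub>C x) = 0" by simp
  then show ?thesis by (simp add: norm_scaleC cinner_same)
qed

lemma diagonal_operator_exists:
  fixes e :: "'i \<Rightarrow> 'a::chilbert_space"
  assumes e: "\<And>i j. cinner (e i) (e j) = (if i = j then 1 else 0)" and d: "\<And>i. \<bar>d i\<bar> \<le> C"
  obtains D where "bounded_clinear D" "\<And>i. D (e i) = (d i :: real) *\<^sub>R e i"
proof -
  have norm_sq: "(norm (\<Sum>i\<in>F. c i *\<^sub>C e i))\<^sup>2 = (\<Sum>i\<in>F. (cmod (c i))\<^sup>2)" if "finite F" for F c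
  proof -
    have "cinner (\<Sum>i\<in>F. c i *\<^sub>C e i) (\<Sum>i\<in>F. c i *\<^sub>C e i) = (\<Sum>i\<in>F. c i * cnj (c i))"
      using that by (simp add: cinner_sum_left cinner_sum_right cinner_scaleC_left cinner_scaleC_right e
          if_distrib[of "(*) _"] sum.delta sum.delta' mult.commute cong: if_cong)
    also have "\<dots> = of_real (\<Sum>i\<in>F. (cmod (c i))\<^sup>2)" by (simp flip: complex_norm_square)
    finally show ?thesis by (simp add: norm_sq_eq_Re_cinner)
  qed
  have C: "0 \<le> C" using d by (meson abs_ge_zero order_trans)
  have "norm (\<Sum>i\<in>F. c i *\<^sub>C (d i *\<^sub>R e i)) \<le> C * norm (\<Sum>i\<in>F. c i *\<^sub>C e i)" if F: "finite F" for F c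
  proof (rule power2_le_imp_le)
    have "(norm (\<Sum>i\<in>F. c i *\<^sub>C (d i *\<^sub>R e i)))\<^sup>2 = (\<Sum>i\<in>F. (cmod (c i) * \<bar>d i\<bar>)\<^sup>2)"
      using norm_sq[OF F, of "\<lambda>i. c i * of_real (d i)"] by (simp add: scaleR_scaleC scaleC_scaleC norm_mult)
    also have "\<dots> \<le> (\<Sum>i\<in>F. (C * cmod (c i))\<^sup>2)"
      by (intro sum_mono power_mono) (simp_all add: mult.commute[of "cmod _" "\<bar>_\<bar>"] mult_right_mono d)
    also have "\<dots> = (C * norm (\<Sum>i\<in>F. c i *\<^sub>C e i))\<^sup>2"
      by (simp add: power_mult_distrib norm_sq[OF F] sum_distrib_left)
    finally show "(norm (\<Sum>i\<in>F. c i *\<^sub>C (d i *\<^sub>R e i)))\<^sup>2 \<le> (C * norm (\<Sum>i\<in>F. c i *\<^sub>C e i))\<^sup>2" .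
  qed (simp add: C)
  then obtain D where "bounded_clinear D" "\<And>i. D (e i) = d i *\<^sub>R e i"
    using bounded_clinear_extension[of "\<lambda>i. d i *\<^sub>R e i" C e] by metis
  then show thesis by (rule that)
qed

text \<open>\<open>adj W \<circ> W\<close> is diagonal with entries \<open>(w i)^2\<close>; weights
  of at least 1 keep the reciprocals bounded, so the diagonal operator \<open>B\<close> is a bounded
  inverse.\<close>

lemma cauchy_dual_expansive_shift:
  fixes e :: "'i \<Rightarrow> 'a::chilbert_space"
  assumes e: "orthonormal_basis e" and W: "bounded_clinear W" "\<And>i. W (e i) = w i *\<^sub>R e (\<sigma> i)"
    and \<sigma>: "inj \<sigma>" and w: "\<And>i. 1 \<le> w i"
  shows "invertible_op (adj W \<circ> W)" "bounded_clinear (cauchy_dual W)"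
    "cauchy_dual W (e i) = (1 / w i) *\<^sub>R e (\<sigma> i)"
proof -
  have ortho: "cinner (e i) (e j) = (if i = j then 1 else 0)" for i j
    using e by (simp add: orthonormal_basis_def)
  note total = orthonormal_basis_total[OF e]
  have D: "adj W (W (e i)) = (w i)\<^sup>2 *\<^sub>R e i" for i
  proof -
    have "adj W (W (e i)) - (w i)\<^sup>2 *\<^sub>R e i = 0"
      by (rule total) (simp add: cinner_diff_right cinner_adj_right[OF W(1)] W(2) cinner_scaleR_left
          cinner_scaleR_right ortho inj_eq[OF \<sigma>] power2_eq_square)
    then show ?thesis by simp
  qed
  have "\<bar>1 / (w i)\<^sup>2\<bar> \<le> 1" for i using w[of i] by (simp add: divide_le_eq one_le_power)
  then obtain B where B: "bounded_clinear B" "\<And>i. B (e i) = (1 / (w i)\<^sup>2) *\<^sub>R e i"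
    using diagonal_operator_exists[of e "\<lambda>i. 1 / (w i)\<^sup>2" 1] ortho by metis
  have cl: "bounded_clinear (adj W \<circ> W)" "bounded_clinear id"
    using bounded_clinear_comp[OF bounded_clinear_adj[OF W(1)] W(1)] bounded_clinear_ident by (simp_all add: id_def)
  have w0: "w i \<noteq> 0" for i using w[of i] by auto
  have inv1: "(adj W \<circ> W) \<circ> B = id"
  proof (rule clinear_eq_on_total[where g = e])
    show "((adj W \<circ> W) \<circ> B) (e i) = id (e i)" for i
      using w0 bounded_clinear_scaleR[OF cl(1)] by (simp add: B(2) D)
  qed (rule total cl B(1) bounded_clinear_comp[OF cl(1) B(1)] bounded_clinear_comp[OF B(1) cl(1)]
      | assumption)+
  have inv2: "B \<circ> (adj W \<circ> W) = id"
  proof (rule clinear_eq_on_total[where g = e])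
    show "(B \<circ> (adj W \<circ> W)) (e i) = id (e i)" for i
      using w0 by (simp add: B D bounded_clinear_scaleR[OF B(1)])
  qed (rule total cl B(1) bounded_clinear_comp[OF cl(1) B(1)] bounded_clinear_comp[OF B(1) cl(1)]
      | assumption)+
  show "invertible_op (adj W \<circ> W)" unfolding invertible_op_def using B(1) inv1 inv2 by blast
  have dual: "cauchy_dual W = W \<circ> B"
    unfolding cauchy_dual_def by (simp add: inv_unique_comp[OF inv1 inv2])
  show "bounded_clinear (cauchy_dual W)" unfolding dual by (rule bounded_clinear_comp[OF W(1) B(1)])
  show "cauchy_dual W (e i) = (1 / w i) *\<^sub>R e (\<sigma> i)"
    using w0[of i] by (simp add: dual B(2) bounded_clinear_scaleR[OF W(1)] W(2) power2_eq_square)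
qed

lemma weighted_2_shift_moments:
  assumes "weighted_2_shift e w1 w2 W1 W2"
  obtains s where "\<And>\<alpha>. 0 < s \<alpha>" "s (0, 0) = 1" "\<And>\<alpha>. s (\<alpha> + (1, 0)) = w1 \<alpha> * s \<alpha>"
    "\<And>\<alpha>. s (\<alpha> + (0, 1)) = w2 \<alpha> * s \<alpha>"
proof -
  have e: "cinner (e \<alpha>) (e \<beta>) = (if \<alpha> = \<beta> then 1 else 0)" for \<alpha> \<beta>
    using assms unfolding weighted_2_shift_def orthonormal_basis_def by blast
  have w: "0 < w1 \<alpha>" "0 < w2 \<alpha>" and cl: "bounded_clinear W1" "bounded_clinear W2"
    and comm: "W1 (W2 x) = W2 (W1 x)"
    and W: "W1 (e \<alpha>) = w1 \<alpha> *\<^sub>R e (\<alpha> + (1, 0))" "W2 (e \<alpha>) = w2 \<alpha> *\<^sub>R e (\<alpha> + (0, 1))" for \<alpha> x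
    using assms unfolding weighted_2_shift_def commuting_pair_def by (auto simp: fun_eq_iff simp del: split_paired_All)
  have w_comm: "w1 (k, Suc l) * w2 (k, l) = w2 (Suc k, l) * w1 (k, l)" for k l
  proof -
    have "(w1 (k, Suc l) * w2 (k, l)) *\<^sub>R e (Suc k, Suc l) = (w2 (Suc k, l) * w1 (k, l)) *\<^sub>R e (Suc k, Suc l)"
      using comm[of "e (k, l)"] by (simp add: W bounded_clinear_scaleR[OF cl(1)] bounded_clinear_scaleR[OF cl(2)] mult.commute)
    moreover have "e (Suc k, Suc l) \<noteq> 0" using e[of "(Suc k, Suc l)" "(Suc k, Suc l)"] by auto
    ultimately show ?thesis by simp
  qed
  \<comment> \<open>The weight collected from the origin to \<open>\<alpha>\<close>, up the second
    axis first and then along the first direction. Commutativity, in the form \<open>w_comm\<close>,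
    makes the choice of path irrelevant.\<close>
  define s where "s \<alpha> = (\<Prod>i<fst \<alpha>. w1 (i, snd \<alpha>)) * (\<Prod>j<snd \<alpha>. w2 (0, j))" for \<alpha>
  have s1: "s (Suc k, l) = w1 (k, l) * s (k, l)" for k l by (simp add: s_def)
  have s2: "s (k, Suc l) = w2 (k, l) * s (k, l)" for k l
  proof (induction k)
    case (Suc k)
    have "s (Suc k, Suc l) = (w1 (k, Suc l) * w2 (k, l)) * s (k, l)" using Suc by (simp add: s1)
    then show ?case by (simp add: w_comm s1)
  qed (simp add: s_def)
  show thesis
  proof (rule that)
    show "0 < s \<alpha>" for \<alpha> unfolding s_def using w by (intro mult_pos_pos prod_pos) auto
    show "s (0, 0) = 1" by (simp add: s_def)
    show "s (\<alpha> + (1, 0)) = w1 \<alpha> * s \<alpha>" "s (\<alpha> + (0, 1)) = w2 \<alpha> * s \<alpha>" for \<alpha>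
      using s1 s2 by (cases \<alpha>; simp)+
  qed
qed

lemma pair_power_shift:
  assumes "\<And>\<alpha>. T1 (f \<alpha>) = f (\<alpha> + (1, 0))" "\<And>\<alpha>. T2 (f \<alpha>) = f (\<alpha> + (0, 1))"
  shows "(T1 ^^ k) ((T2 ^^ l) (f \<alpha>)) = f (\<alpha> + (k, l))"
proof -
  have "(T2 ^^ l) (f \<alpha>) = f (\<alpha> + (0, l))"
    by (induction l) (simp_all add: assms(2) add.assoc flip: zero_prod_def)
  moreover have "(T1 ^^ k) (f \<beta>) = f (\<beta> + (k, 0))" for \<beta>
    by (induction k) (simp_all add: assms(1) add.assoc flip: zero_prod_def)
  ultimately show ?thesis by (simp add: add.assoc)
qed

lemma commuting_pair_of_shift:
  fixes f :: "nat \<times> nat \<Rightarrow> 'a::chilbert_space"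
  assumes cl: "bounded_clinear T1" "bounded_clinear T2" and total: "\<And>x. (\<And>\<alpha>. cinner (f \<alpha>) x = 0) \<Longrightarrow> x = 0"
    and T: "\<And>\<alpha>. T1 (f \<alpha>) = f (\<alpha> + (1, 0))" "\<And>\<alpha>. T2 (f \<alpha>) = f (\<alpha> + (0, 1))"
  shows "commuting_pair T1 T2"
proof -
  have "T1 \<circ> T2 = T2 \<circ> T1"
    by (rule clinear_eq_on_total[where g = f]) (simp_all add: bounded_clinear_comp cl T add_ac total)
  then show ?thesis using cl by (simp add: commuting_pair_def)
qed

text \<open>Each defect operator \<open>R \<beta>\<close> is diagonal on \<open>f\<close>, with a
  mixed difference of \<open>\<gamma>\<close> as numerator. As \<open>\<gamma>\<close> is affine in
  each variable, the differences of type (2, 0) and (0, 2) vanish, and that of type (1, 1) is the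
  constant \<open>c\<close>.\<close>

lemma toral_2_isometry_iff:
  fixes f :: "nat \<times> nat \<Rightarrow> 'a::chilbert_space"
  assumes pair: "commuting_pair T1 T2" and total: "\<And>x. (\<And>\<alpha>. cinner (f \<alpha>) x = 0) \<Longrightarrow> x = 0"
    and T: "\<And>\<alpha>. T1 (f \<alpha>) = f (\<alpha> + (1, 0))" "\<And>\<alpha>. T2 (f \<alpha>) = f (\<alpha> + (0, 1))"
    and f: "\<And>\<alpha> \<beta>. cinner (f \<alpha>) (f \<beta>) = of_real (if \<alpha> = \<beta> then \<gamma> \<alpha> else 0)" and pos: "\<And>\<alpha>. 0 < \<gamma> \<alpha>"
    and \<gamma>: "\<And>k l. \<gamma> (k, l) = 1 + a * real k + b * real l + c * real k * real l"
  shows "toral_isometry 2 T1 T2 \<longleftrightarrow> c = 0"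
proof -
  define R where "R \<beta> x = (\<Sum>\<alpha>\<in>{..fst \<beta>} \<times> {..snd \<beta>}.
    ((-1) ^ (fst \<alpha> + snd \<alpha>) * real (fst \<beta> choose fst \<alpha>) * real (snd \<beta> choose snd \<alpha>))
      *\<^sub>R adj (pair_power T1 T2 \<alpha>) (pair_power T1 T2 \<alpha> x))" for \<beta> x
  define r where "r \<beta> \<kappa> = (\<Sum>\<alpha>\<in>{..fst \<beta>} \<times> {..snd \<beta>}.
    ((-1) ^ (fst \<alpha> + snd \<alpha>) * real (fst \<beta> choose fst \<alpha>) * real (snd \<beta> choose snd \<alpha>)) * \<gamma> (\<kappa> + \<alpha>))" for \<beta> \<kappa>
  have cl: "bounded_clinear T1" "bounded_clinear T2" using pair by (auto simp: commuting_pair_def)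
  have clP: "bounded_clinear (pair_power T1 T2 \<alpha>)" for \<alpha>
    unfolding pair_power_def by (intro bounded_clinear_comp bounded_clinear_funpow cl)
  have P: "pair_power T1 T2 \<alpha> (f \<kappa>) = f (\<kappa> + \<alpha>)" for \<alpha> \<kappa>
    using pair_power_shift[of T1 f T2, OF T] by (simp add: pair_power_def)
  have clR: "bounded_clinear (R \<beta>)" for \<beta>
    unfolding R_def[abs_def]
    by (rule bounded_clinear_fun_sum, rule bounded_clinear_fun_scaleR,
        rule bounded_clinear_compose[OF bounded_clinear_adj[OF clP] clP])
  have adjP: "adj (pair_power T1 T2 \<alpha>) (f (\<kappa> + \<alpha>)) = (\<gamma> (\<kappa> + \<alpha>) / \<gamma> \<kappa>) *\<^sub>R f \<kappa>" for \<alpha> \<kappa>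
  proof -
    have "adj (pair_power T1 T2 \<alpha>) (f (\<kappa> + \<alpha>)) - (\<gamma> (\<kappa> + \<alpha>) / \<gamma> \<kappa>) *\<^sub>R f \<kappa> = 0"
      using pos[of \<kappa>]
      by (intro total) (simp add: cinner_diff_right cinner_adj_right[OF clP] P f cinner_scaleR_right)
    then show ?thesis by simp
  qed
  have R_f: "R \<beta> (f \<kappa>) = (r \<beta> \<kappa> / \<gamma> \<kappa>) *\<^sub>R f \<kappa>" for \<beta> \<kappa>
    by (simp add: R_def r_def P adjP scaleR_left.sum sum_divide_distrib)
  have "R \<beta> = (\<lambda>x. 0) \<longleftrightarrow> (\<forall>\<kappa>. r \<beta> \<kappa> = 0)" for \<beta>
  proof
    assume *: "R \<beta> = (\<lambda>x. 0)"
    have "f \<kappa> \<noteq> 0" for \<kappa> using f[of \<kappa> \<kappa>] pos[of \<kappa>] by auto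
    then show "\<forall>\<kappa>. r \<beta> \<kappa> = 0" using R_f[of \<beta>] pos unfolding * by (metis divide_eq_0_iff less_irrefl scale_eq_0_iff)
  next
    assume *: "\<forall>\<kappa>. r \<beta> \<kappa> = 0"
    show "R \<beta> = (\<lambda>x. 0)"
      by (rule clinear_eq_on_total[where g = f])
        (simp_all add: clR bounded_clinear_const_zero R_f * total)
  qed
  then have iff: "toral_isometry 2 T1 T2 \<longleftrightarrow> (\<forall>\<beta>. fst \<beta> + snd \<beta> = 2 \<longrightarrow> (\<forall>\<kappa>. r \<beta> \<kappa> = 0))"
    unfolding toral_isometry_def using pair by (auto simp: R_def[symmetric] fun_eq_iff)
  have cases2: "\<beta> = (2, 0) \<or> \<beta> = (1, 1) \<or> \<beta> = (0, 2)" if "fst \<beta> + snd \<beta> = 2" for \<beta> :: "nat \<times> nat"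
    using that by (cases \<beta>) auto
  have sets: "{..2::nat} \<times> {..0::nat} = {(0, 0), (1, 0), (2, 0)}"
    "{..0::nat} \<times> {..2::nat} = {(0, 0), (0, 1), (0, 2)}"
    "{..1::nat} \<times> {..1::nat} = {(0, 0), (0, 1), (1, 0), (1, 1)}"
    by auto
  have r20: "r (2, 0) \<kappa> = 0" and r02: "r (0, 2) \<kappa> = 0" and r11: "r (1, 1) \<kappa> = c" for \<kappa>
    unfolding r_def fst_conv snd_conv sets
    by (cases \<kappa>; simp add: \<gamma> algebra_simps)+
  show ?thesis unfolding iff using cases2 r20 r02 r11 by (metis fst_conv snd_conv one_add_one)
qed

text \<open>A 2-isometry makes squared norms affine along its orbits, so \<open>\<gamma>\<close> is
  affine in each variable. The signs come from \<open>\<gamma> \<ge> 0\<close>: slopes of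
  nonnegative affine sequences are nonnegative, which gives \<open>a + c l \<ge> 0\<close> for all
  \<open>l\<close> and, applied once more, \<open>c \<ge> 0\<close>.\<close>

lemma separate_2_isometry_moments:
  fixes f :: "nat \<times> nat \<Rightarrow> 'a::chilbert_space"
  assumes iso: "m_isometry 2 T1" "m_isometry 2 T2"
    and T: "\<And>\<alpha>. T1 (f \<alpha>) = f (\<alpha> + (1, 0))" "\<And>\<alpha>. T2 (f \<alpha>) = f (\<alpha> + (0, 1))"
    and norm_f: "\<And>\<alpha>. (norm (f \<alpha>))\<^sup>2 = \<gamma> \<alpha>" and \<gamma>0: "\<gamma> (0, 0) = 1"
  obtains a b c where "0 \<le> a" "0 \<le> b" "0 \<le> c"
    "\<And>k l. \<gamma> (k, l) = 1 + a * real k + b * real l + c * real k * real l"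
proof -
  have "\<gamma> (k, l) - 2 * \<gamma> (Suc k, l) + \<gamma> (Suc (Suc k), l) = 0" for k l
    using m_isometry_2_norm[OF iso(1), of "f (k, l)"] by (simp add: T norm_f)
  from second_difference_zero_imp_affine[of "\<lambda>k. \<gamma> (k, l)" for l, OF this]
  have aff1: "\<gamma> (k, l) = \<gamma> (0, l) + real k * (\<gamma> (1, l) - \<gamma> (0, l))" for k l .
  have "\<gamma> (k, l) - 2 * \<gamma> (k, Suc l) + \<gamma> (k, Suc (Suc l)) = 0" for k l
    using m_isometry_2_norm[OF iso(2), of "f (k, l)"] by (simp add: T norm_f)
  from second_difference_zero_imp_affine[of "\<lambda>l. \<gamma> (k, l)" for k, OF this]
  have aff2: "\<gamma> (k, l) = \<gamma> (k, 0) + real l * (\<gamma> (k, 1) - \<gamma> (k, 0))" for k l .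
  define a b c where "a = \<gamma> (1, 0) - 1" and "b = \<gamma> (0, 1) - 1"
    and "c = \<gamma> (1, 1) - \<gamma> (1, 0) - \<gamma> (0, 1) + 1"
  have \<gamma>: "\<gamma> (k, l) = 1 + a * real k + b * real l + c * real k * real l" for k l
    unfolding aff1[of k l] aff2[of 0 l] aff2[of 1 l]
    by (simp add: a_def b_def c_def \<gamma>0 algebra_simps)
  have pos: "0 \<le> \<gamma> \<alpha>" for \<alpha> unfolding norm_f[symmetric] by simp
  have slope: "0 \<le> a + c * real l" for l
    by (rule affine_nonneg_imp_slope_nonneg[of "1 + b * real l"])
      (use pos[of "(_, l)"] in \<open>simp add: \<gamma> algebra_simps\<close>)
  show thesis
  proof (rule that)
    show "0 \<le> a" using slope[of 0] by simp
    show "0 \<le> b" by (rule affine_nonneg_imp_slope_nonneg[of 1]) (use pos[of "(0, _)"] in \<open>simp add: \<gamma>\<close>)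
    show "0 \<le> c" by (rule affine_nonneg_imp_slope_nonneg[OF slope])
  qed (rule \<gamma>)
qed

lemma jointly_subnormal_moment_condition:
  fixes f :: "nat \<times> nat \<Rightarrow> 'a::chilbert_space"
  assumes sub: "jointly_subnormal_in (K :: 'k::chilbert_space itself) T1 T2"
    and T: "\<And>\<alpha>. T1 (f \<alpha>) = f (\<alpha> + (1, 0))" "\<And>\<alpha>. T2 (f \<alpha>) = f (\<alpha> + (0, 1))"
    and norm_f: "\<And>k l. (norm (f (k, l)))\<^sup>2 = 1 / (1 + a * real k + b * real l + c * real k * real l)"
    and nonneg: "0 \<le> a" "0 \<le> b" "0 < c"
  shows "c \<le> a * b"
proof -
  from sub obtain V :: "'a \<Rightarrow> 'k" and N1 N2 where V: "linear_isometry V"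
    and N: "normal_op N1" "normal_op N2" and eqs: "N1 \<circ> N2 = N2 \<circ> N1" "N1 \<circ> V = V \<circ> T1" "N2 \<circ> V = V \<circ> T2"
    unfolding jointly_subnormal_in_def by blast
  have "(N1 ^^ k) ((N2 ^^ l) (V (f (0, 0)))) = V (f ((0, 0) + (k, l)))" for k l
    by (rule pair_power_shift[of N1 "\<lambda>\<alpha>. V (f \<alpha>)" N2]) (use eqs T in \<open>simp_all add: fun_eq_iff\<close>)
  moreover have "(norm (V x))\<^sup>2 = (norm x)\<^sup>2" for x
    using V by (simp add: linear_isometry_def norm_sq_eq_Re_cinner)
  ultimately show ?thesis
    using eqs(1) norm_f by (intro moment_coefficients_of_normal_pair[OF N _ _ nonneg, of "V (f (0, 0))"])
      (simp_all add: fun_eq_iff)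
qed

text \<open>The last conjunct lets an extension on an arbitrary carrier \<open>K\<close> be replaced
  by one on \<open>'h\<close>, so that subnormality in \<open>TYPE('h)\<close> captures joint
  subnormality with no restriction on the larger space.\<close>

theorem theorem4p9:
  fixes e :: "nat \<times> nat \<Rightarrow> 'h::chilbert_space"
    and w1 w2 :: "nat \<times> nat \<Rightarrow> real"
    and W1 W2 :: "'h \<Rightarrow> 'h"
    and K :: "'k::chilbert_space itself"
  assumes "weighted_2_shift e w1 w2 W1 W2"
    and "toral_isometry 3 W1 W2"
    and "separate_isometry 2 W1 W2"
  shows "toral_cauchy_dual_exists W1 W2 \<and>
    (jointly_subnormal_in TYPE('h) (cauchy_dual W1) (cauchy_dual W2) \<longleftrightarrow>
      (1 - (w1 (0, 0))\<^sup>2 - (w2 (0, 0))\<^sup>2 + (w1 (0, 0))\<^sup>2 * (w2 (1, 0))\<^sup>2 = 0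
        \<or> w2 (1, 0) \<le> w2 (0, 0))) \<and>
    (1 - (w1 (0, 0))\<^sup>2 - (w2 (0, 0))\<^sup>2 + (w1 (0, 0))\<^sup>2 * (w2 (1, 0))\<^sup>2 = 0
        \<or> w2 (1, 0) \<le> w2 (0, 0)
      \<longleftrightarrow> toral_isometry 2 W1 W2 \<or> w2 (1, 0) \<le> w2 (0, 0)) \<and>
    (jointly_subnormal_in K (cauchy_dual W1) (cauchy_dual W2) \<longrightarrow>
      jointly_subnormal_in TYPE('h) (cauchy_dual W1) (cauchy_dual W2))"
proof -
  have e: "orthonormal_basis e" and w: "\<And>\<alpha>. 0 < w1 \<alpha>" "\<And>\<alpha>. 0 < w2 \<alpha>"
    and W: "commuting_pair W1 W2" "\<And>\<alpha>. W1 (e \<alpha>) = w1 \<alpha> *\<^sub>R e (\<alpha> + (1, 0))" "\<And>\<alpha>. W2 (e \<alpha>) = w2 \<alpha> *\<^sub>R e (\<alpha> + (0, 1))"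
    using assms(1) unfolding weighted_2_shift_def by blast+
  have ortho: "cinner (e \<alpha>) (e \<beta>) = (if \<alpha> = \<beta> then 1 else 0)" for \<alpha> \<beta>
    using e unfolding orthonormal_basis_def by blast
  have cl: "bounded_clinear W1" "bounded_clinear W2" using W(1) by (auto simp: commuting_pair_def)
  have iso: "m_isometry 2 W1" "m_isometry 2 W2" using assms(3) by (auto simp: separate_isometry_def)
  obtain s where s: "\<And>\<alpha>. 0 < s \<alpha>" "s (0, 0) = 1" "\<And>\<alpha>. s (\<alpha> + (1, 0)) = w1 \<alpha> * s \<alpha>"
    "\<And>\<alpha>. s (\<alpha> + (0, 1)) = w2 \<alpha> * s \<alpha>"
    using weighted_2_shift_moments[OF assms(1)] by blast
  have s0: "s \<alpha> \<noteq> 0" "w1 \<alpha> \<noteq> 0" "w2 \<alpha> \<noteq> 0" for \<alpha> using s(1)[of \<alpha>] w[of \<alpha>] by auto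
  have total: "x = 0" if "\<And>\<alpha>. cinner (r \<alpha> *\<^sub>R e \<alpha>) x = 0" "\<And>\<alpha>. r \<alpha> \<noteq> 0" for r :: "nat \<times> nat \<Rightarrow> real" and x
    by (rule orthonormal_basis_total[OF e]) (use that in \<open>simp add: cinner_scaleR_left\<close>)
  have gram: "cinner (r \<alpha> *\<^sub>R e \<alpha>) (r \<beta> *\<^sub>R e \<beta>) = of_real (if \<alpha> = \<beta> then (r \<alpha>)\<^sup>2 else 0)"
    for r :: "nat \<times> nat \<Rightarrow> real" and \<alpha> \<beta>
    by (simp add: cinner_scaleR_left cinner_scaleR_right ortho power2_eq_square)
  have norm_e: "(norm (r *\<^sub>R e \<alpha>))\<^sup>2 = r\<^sup>2" for r :: real and \<alpha>
    unfolding norm_sq_eq_Re_cinner gram[of "\<lambda>_. r" \<alpha> \<alpha>] by simp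

  \<comment> \<open>\<open>f \<alpha>\<close> is the orbit of \<open>e (0, 0)\<close>: both shifts
    act on it without weights, and its squared norms are the moments.\<close>
  define f where "f \<alpha> = s \<alpha> *\<^sub>R e \<alpha>" for \<alpha>
  have f: "W1 (f \<alpha>) = f (\<alpha> + (1, 0))" "W2 (f \<alpha>) = f (\<alpha> + (0, 1))" for \<alpha>
    unfolding f_def s by (simp_all only: bounded_clinear_scaleR[OF cl(1)] bounded_clinear_scaleR[OF cl(2)] W(2,3)
        scaleR_scaleR mult.commute)
  obtain a b c where nonneg: "0 \<le> a" "0 \<le> b" "0 \<le> c"
    and moments: "\<And>k l. (s (k, l))\<^sup>2 = 1 + a * real k + b * real l + c * real k * real l"
  proof (rule separate_2_isometry_moments[OF iso f, of "\<lambda>\<alpha>. (s \<alpha>)\<^sup>2"])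
    show "(norm (f \<alpha>))\<^sup>2 = (s \<alpha>)\<^sup>2" for \<alpha> unfolding f_def by (rule norm_e)
  qed (simp_all add: s(2))

  \<comment> \<open>Nonnegative coefficients make the moments nondecreasing in both directions,
    hence the shifts expansive.\<close>
  have w_ge: "1 \<le> w1 \<alpha>" "1 \<le> w2 \<alpha>" for \<alpha>
  proof -
    obtain k l where kl: "\<alpha> = (k, l)" by (cases \<alpha>)
    have "(s \<alpha>)\<^sup>2 \<le> (s (\<alpha> + (1, 0)))\<^sup>2" "(s \<alpha>)\<^sup>2 \<le> (s (\<alpha> + (0, 1)))\<^sup>2"
      using nonneg by (simp_all add: kl moments algebra_simps)
    then have "s \<alpha> \<le> w1 \<alpha> * s \<alpha>" "s \<alpha> \<le> w2 \<alpha> * s \<alpha>"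
      using s(1)[of \<alpha>] w[of \<alpha>] unfolding s by (auto intro: power2_le_imp_le)
    then show "1 \<le> w1 \<alpha>" "1 \<le> w2 \<alpha>" using s(1)[of \<alpha>] by simp_all
  qed
  have inj: "inj (\<lambda>\<alpha> :: nat \<times> nat. \<alpha> + \<epsilon>)" for \<epsilon> by (simp add: inj_def)
  note dual1 = cauchy_dual_expansive_shift[OF e cl(1) W(2) inj w_ge(1)]
  note dual2 = cauchy_dual_expansive_shift[OF e cl(2) W(3) inj w_ge(2)]
  define T1 T2 where "T1 = cauchy_dual W1" and "T2 = cauchy_dual W2"
  \<comment> \<open>The orbit of \<open>e (0, 0)\<close> under the dual pair, whose weights are
    reciprocal; so are its squared norms.\<close>
  define h where "h \<alpha> = (1 / s \<alpha>) *\<^sub>R e \<alpha>" for \<alpha>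
  have clT: "bounded_clinear T1" "bounded_clinear T2" unfolding T1_def T2_def by (rule dual1(2) dual2(2))+
  have h: "T1 (h \<alpha>) = h (\<alpha> + (1, 0))" "T2 (h \<alpha>) = h (\<alpha> + (0, 1))" for \<alpha>
    unfolding h_def s bounded_clinear_scaleR[OF clT(1)] bounded_clinear_scaleR[OF clT(2)]
    by (simp_all add: T1_def T2_def dual1(3) dual2(3) mult.commute)
  have total_h: "x = 0" if "\<And>\<alpha>. cinner (h \<alpha>) x = 0" for x
    by (rule total[of "\<lambda>\<alpha>. 1 / s \<alpha>"]) (use that s0 in \<open>simp_all add: h_def\<close>)
  have total_f: "x = 0" if "\<And>\<alpha>. cinner (f \<alpha>) x = 0" for x
    by (rule total[of s]) (use that s0 in \<open>simp_all add: f_def\<close>)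
  have pair: "commuting_pair T1 T2" by (rule commuting_pair_of_shift[OF clT total_h h])
  have exists: "toral_cauchy_dual_exists W1 W2"
    unfolding toral_cauchy_dual_exists_def using dual1(1) dual2(1) by blast

  \<comment> \<open>Kept polymorphic in the carrier, as it is applied both to \<open>K\<close> and
    to \<open>TYPE('h)\<close>.\<close>
  have necessary: "c = 0 \<or> c \<le> a * b" if "jointly_subnormal_in L T1 T2"
    for L :: "'x::chilbert_space itself"
    using that
  proof (cases "c = 0")
    case False
    have "c \<le> a * b"
    proof (rule jointly_subnormal_moment_condition[OF that h])
      show "(norm (h (k, l)))\<^sup>2 = 1 / (1 + a * real k + b * real l + c * real k * real l)" for k l
        unfolding h_def norm_e moments[symmetric] by (simp add: power_divide)
    qed (use nonneg False in auto)
    then show ?thesis ..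
  qed simp
  have sufficient: "jointly_subnormal_in TYPE('h) T1 T2" if "c = 0 \<or> c \<le> a * b"
  proof (rule jointly_subnormal_of_gram_kernel[where f = h and u = "\<lambda>n. e (prod_decode n)"
        and \<delta> = "\<lambda>(k, l). 1 / (1 + a * real k + b * real l + c * real k * real l)"])
    show "cinner (h \<alpha>) (h \<beta>) = of_real (if \<alpha> = \<beta> then
        (case \<alpha> of (k, l) \<Rightarrow> 1 / (1 + a * real k + b * real l + c * real k * real l)) else 0)" for \<alpha> \<beta>
      unfolding h_def gram[of "\<lambda>\<alpha>. 1 / s \<alpha>"] by (cases \<alpha>; cases \<beta>) (auto simp: moments power_divide)
    show "cinner (e (prod_decode i)) (e (prod_decode j)) = (if i = j then 1 else 0)" for i j
      by (simp add: ortho inj_eq[OF inj_prod_decode])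
    show "(case \<alpha> of (k, l) \<Rightarrow> 1 / (1 + a * real k + b * real l + c * real k * real l)) \<le> 1" for \<alpha>
    proof (cases \<alpha>)
      case (Pair k l)
      have "1 \<le> 1 + a * real k + b * real l + c * real k * real l" using nonneg by simp
      then show ?thesis unfolding Pair by (simp add: divide_le_eq_1)
    qed
    show "gram_kernel (normal_kernel (\<lambda>(k, l). 1 / (1 + a * real k + b * real l + c * real k * real l)))"
      by (rule gram_kernel_normal_kernel[OF nonneg that])
  qed (fact total_h pair h)+
  have toral: "toral_isometry 2 W1 W2 \<longleftrightarrow> c = 0"
  proof (rule toral_2_isometry_iff[OF W(1) total_f f])
    show "cinner (f \<alpha>) (f \<beta>) = of_real (if \<alpha> = \<beta> then (s \<alpha>)\<^sup>2 else 0)" for \<alpha> \<beta> unfolding f_def by (rule gram)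
  qed (use s0 moments in auto)

  have w10: "(w1 (0, 0))\<^sup>2 = 1 + a" using moments[of 1 0] s(3)[of "(0, 0)"] s(2) by simp
  have w20: "(w2 (0, 0))\<^sup>2 = 1 + b" using moments[of 0 1] s(4)[of "(0, 0)"] s(2) by simp
  have w12: "(w1 (0, 0))\<^sup>2 * (w2 (1, 0))\<^sup>2 = 1 + a + b + c"
    using moments[of 1 1] s(3)[of "(0, 0)"] s(4)[of "(1, 0)"] s(2) by (simp add: power_mult_distrib mult.commute)
  have ii1: "1 - (w1 (0, 0))\<^sup>2 - (w2 (0, 0))\<^sup>2 + (w1 (0, 0))\<^sup>2 * (w2 (1, 0))\<^sup>2 = 0 \<longleftrightarrow> c = 0"
    unfolding w12 unfolding w10 w20 by auto
  have ii2: "w2 (1, 0) \<le> w2 (0, 0) \<longleftrightarrow> c \<le> a * b"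
  proof -
    \<comment> \<open>After squaring and multiplying by \<open>(w1 (0, 0))^2\<close> the comparison
      reads \<open>1 + a + b + c \<le> (1 + a) * (1 + b)\<close>.\<close>
    have "w2 (1, 0) \<le> w2 (0, 0) \<longleftrightarrow> (w2 (1, 0))\<^sup>2 \<le> (w2 (0, 0))\<^sup>2"
      using w(2)[of "(1, 0)"] w(2)[of "(0, 0)"] by (simp add: power2_le_iff_abs_le)
    also have "\<dots> \<longleftrightarrow> (w1 (0, 0))\<^sup>2 * (w2 (1, 0))\<^sup>2 \<le> (w1 (0, 0))\<^sup>2 * (w2 (0, 0))\<^sup>2"
      using w(1)[of "(0, 0)"] by simp
    also have "\<dots> \<longleftrightarrow> c \<le> a * b" unfolding w12 unfolding w10 w20 by (simp add: algebra_simps)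
    finally show ?thesis .
  qed
  show ?thesis
    unfolding ii1 ii2 toral T1_def[symmetric] T2_def[symmetric]
    using exists necessary[of K] necessary[of "TYPE('h)"] sufficient by blast
qed

end
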